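(* Let $(C,0)$ be a reduced complex analytic curve germ with irreducible decomposition $C=\bigcup_{i\in I}C_i$ ($I$ finite), and for $\emptyset\neq J\subset I$ let $C_J:=\bigcup_{j\in J}C_j$, with Poincaré series $P_{C_J}(\mathbf t_J)$. Let $\delta$ denote the delta invariant and $\mathrm{pc}$ the periodic constant of a one-variable series. Then: (a) for every $i\in I$ one has $\delta(C_i)=-\mathrm{pc}(P_{C_i}(t_i))$; (b) $$\delta(C)=\sum_{i\in I}\delta(C_i)+\sum_{J\subset I,\ |J|>1}(-1)^{|J|}\,P_{C_J}(1_J),$$ where $P_{C_J}(1_J)$ is the value of the polynomial $P_{C_J}(\mathbf t_J)$ at $t_j=1$ for all $j\in J$.
   Context: Delta invariant: if $\gamma:(C,0)^{\sim}\to(C,0)$ is the normalization ($(C,0)^\sim$ a multigerm), then $\delta(C):=\dim_{\mathbb C}\gamma_*\mathcal O_{(C,0)^\sim}/\mathcal O_{(C,0)}$. Hilbert and Poincaré series: let $(C,0)=\bigcup_{i\in I}(C_i,0)$ be reduced, with $\gamma_i:(\mathbb C,0)\to(C_i,0)$ a normalization of the branch $C_i$. For $g\in\mathcal O_{C,0}$ set $v_i(g):=\mathrm{ord}_t\, g(\gamma_i(t))\in\mathbb Z_{\ge0}\cup\{\infty\}$ and $v(g)=(v_i(g))_{i\in I}$. For $\ell\in\mathbb Z^{I}$ put $\mathcal F_C(\ell):=\{g\in\mathcal O_{C,0}: v(g)\ge\ell\}$ (coordinatewise), $\mathfrak h_C(\ell):=\dim_{\mathbb C}\mathcal O_{C,0}/\mathcal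 F_C(\ell)$, and $H_C(\mathbf t_I):=\sum_{\ell\in\mathbb Z^I}\mathfrak h_C(\ell)\mathbf t_I^{\ell}$, where $\mathbf t_I=(t_i)_{i\in I}$, $\mathbf t_I^\ell=\prod_{i\in I} t_i^{\ell_i}$. The Poincaré series is $P_C(\mathbf t_I):=-H_C(\mathbf t_I)\cdot\prod_{i\in I}(1-t_i^{-1})$; that is, $P_C(\mathbf t_I)=\sum_\ell\mathfrak p_C(\ell)\mathbf t_I^\ell$ with $\mathfrak p_C(\ell)=\sum_{J\subset I}(-1)^{|J|+1}\mathfrak h_C(\ell+1_J)$, where $1_J\in\mathbb Z^I$ is the sum of the standard basis vectors indexed by $J$ ($1_\emptyset=0$). The same definitions are applied to each $C_J$ with index set $J$. It is known that $P_{C_J}$ is a polynomial whenever $|J|\ge2$, so $P_{C_J}(1_J)$ makes sense. Periodic constant of a one-variable series $S(t)=\sum_{\ell\ge0}c_\ell t^\ell\in\mathbb Z[[t]]$: if for some $p\in\mathbb Z_{>0}$ the function $n\mapsto\sum_{\ell=0}^{pn-1}c_\ell$ coincides with a polynomial $\widetilde Q^{(p)}(n)$ for all sufficiently large $n$, then $\mathrm{pc}(S):=\widetilde Q^{(p)}(0)$; this is independent of $p$. *)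

theory Defs
  imports
    "HOL-Complex_Analysis.Complex_Analysis"
    "HOL-Library.Extended_Nat"
    "HOL-Library.Function_Algebras"
begin

section \<open>Analytic germs at the origin of complex n-space\<close>

text \<open>
  Every complex analytic germ is, up to isomorphism, a germ at \<open>0\<close> of an analytic subset of some
  \<open>\<complex>\<^sup>n\<close>; here \<open>\<complex>\<^sup>n\<close> is \<open>complex ^ 'n\<close>. Set germs and function germs are handled through
  representatives, and all notions below depend only on the germs.
\<close>

text \<open>Holomorphic functions of several variables: complex differentiable at each point.\<close>

definition holomorphic_cn :: "((complex ^ 'n) \<Rightarrow> complex) \<Rightarrow> (complex ^ 'n) set \<Rightarrow> bool" where
  "holomorphic_cn f U \<longleftrightarrow>
     (\<forall>z\<in>U. \<exists>L. (f has_derivative L) (at z) \<and> (\<forall>c x. L (c *s x) = c * L x))"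

definition holomorphic_germs :: "((complex ^ 'n) \<Rightarrow> complex) set" where
  "holomorphic_germs = {f. \<exists>U. open U \<and> 0 \<in> U \<and> holomorphic_cn f U}"

definition germ_le :: "(complex ^ 'n) set \<Rightarrow> (complex ^ 'n) set \<Rightarrow> bool" where
  "germ_le X Y \<longleftrightarrow> (\<forall>\<^sub>F z in nhds 0. z \<in> X \<longrightarrow> z \<in> Y)"

definition germ_eq :: "(complex ^ 'n) set \<Rightarrow> (complex ^ 'n) set \<Rightarrow> bool" where
  "germ_eq X Y \<longleftrightarrow> (\<forall>\<^sub>F z in nhds 0. z \<in> X \<longleftrightarrow> z \<in> Y)"

definition analytic_germ :: "(complex ^ 'n) set \<Rightarrow> bool" where
  "analytic_germ X \<longleftrightarrow>
     (\<exists>U F. open U \<and> 0 \<in> U \<and> finite F \<and> (\<forall>f\<in>F. holomorphic_cn f U) \<and>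
            X \<inter> U = {z \<in> U. \<forall>f\<in>F. f z = 0})"

definition irreducible_germ :: "(complex ^ 'n) set \<Rightarrow> bool" where
  "irreducible_germ X \<longleftrightarrow>
     analytic_germ X \<and> 0 \<in> X \<and>
     (\<forall>Y Z. analytic_germ Y \<and> analytic_germ Z \<and> germ_eq X (Y \<union> Z) \<longrightarrow> germ_eq X Y \<or> germ_eq X Z)"

definition irreducible_component :: "(complex ^ 'n) set \<Rightarrow> (complex ^ 'n) set \<Rightarrow> bool" where
  "irreducible_component Y X \<longleftrightarrow>
     irreducible_germ Y \<and> germ_le Y X \<and>
     (\<forall>Z. irreducible_germ Z \<and> germ_le Y Z \<and> germ_le Z X \<longrightarrow> germ_eq Y Z)"

text \<open>
  The dimension of an analytic germ is the least number of holomorphic function germs whose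
  common zeros on the germ reduce to the origin.
\<close>

definition germ_dim :: "(complex ^ 'n) set \<Rightarrow> nat" where
  "germ_dim X = (LEAST d. \<exists>F. finite F \<and> card F = d \<and> F \<subseteq> holomorphic_germs \<and>
                          germ_eq (X \<inter> {z. \<forall>f\<in>F. f z = 0}) {0})"

text \<open>
  A reduced germ is determined by its underlying set germ; a curve germ has pure dimension one.
\<close>

definition curve_germ :: "(complex ^ 'n) set \<Rightarrow> bool" where
  "curve_germ X \<longleftrightarrow>
     analytic_germ X \<and> 0 \<in> X \<and> (\<forall>Y. irreducible_component Y X \<longrightarrow> germ_dim Y = 1)"

definition irreducible_decomposition ::
    "'i set \<Rightarrow> ('i \<Rightarrow> (complex ^ 'n) set) \<Rightarrow> (complex ^ 'n) set \<Rightarrow> bool" where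
  "irreducible_decomposition I C X \<longleftrightarrow>
     finite I \<and> (\<forall>i\<in>I. irreducible_germ (C i)) \<and> germ_eq X (\<Union>i\<in>I. C i) \<and>
     (\<forall>i\<in>I. \<forall>j\<in>I. i \<noteq> j \<longrightarrow> \<not> germ_le (C i) (C j))"

section \<open>Normalization of a branch\<close>

text \<open>
  A normalization is a finite (that is, proper with finite fibres) holomorphic map from a normal
  space which is an isomorphism over the complement of a nowhere dense analytic subset. On an
  irreducible curve germ the only nonempty nowhere dense analytic subgerm is the origin, whence
  the following form: after shrinking, \<open>g\<close> is proper and bijective from a
  neighbourhood of \<open>0 \<in> \<complex>\<close> onto a neighbourhood of \<open>0\<close> in \<open>X\<close>, and away from the origin its inverse
  is locally the restriction of a holomorphic function of the ambient space.
\<close>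

definition normalization :: "(complex \<Rightarrow> complex ^ 'n) \<Rightarrow> (complex ^ 'n) set \<Rightarrow> bool" where
  "normalization g X \<longleftrightarrow>
     g 0 = 0 \<and>
     (\<exists>D U. open D \<and> 0 \<in> D \<and> open U \<and> 0 \<in> U \<and>
        (\<forall>k. (\<lambda>t. g t $ k) holomorphic_on D) \<and>
        bij_betw g D (X \<inter> U) \<and>
        proper_map (top_of_set D) (top_of_set (X \<inter> U)) g \<and>
        (\<forall>t\<in>D - {0}. \<exists>W s. open W \<and> g t \<in> W \<and> holomorphic_cn s W \<and>
                           (\<forall>u\<in>D. g u \<in> W \<longrightarrow> s (g u) = u)))"

section \<open>Dimension of a quotient vector space\<close>

text \<open>
  \<open>dim (V / W)\<close> for subspaces \<open>W \<subseteq> V\<close> of an ambient vector space: the supremum of the sizes of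
  finite subsets of \<open>V\<close> that are linearly independent modulo \<open>W\<close>, and \<open>\<infinity>\<close> if the quotient is
  infinite-dimensional.
\<close>

definition quotient_dim ::
    "('k::field \<Rightarrow> 'v::ab_group_add \<Rightarrow> 'v) \<Rightarrow> 'v set \<Rightarrow> 'v set \<Rightarrow> enat" where
  "quotient_dim sc V W =
     (SUP B \<in> {B. finite B \<and> B \<subseteq> V \<and> \<not> module.dependent sc B \<and>
                  module.span sc B \<inter> W \<subseteq> {0}}. enat (card B))"

definition scale_fun :: "complex \<Rightarrow> ((complex ^ 'n) \<Rightarrow> complex) \<Rightarrow> (complex ^ 'n) \<Rightarrow> complex" where
  "scale_fun c f = (\<lambda>z. c * f z)"

definition scale_fps :: "complex \<Rightarrow> ('i \<Rightarrow> complex fps) \<Rightarrow> 'i \<Rightarrow> complex fps" where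
  "scale_fps c a = (\<lambda>i. fps_const c * a i)"

lemma vector_space_scale_fun: "vector_space scale_fun"
  by standard (auto simp: scale_fun_def fun_eq_iff algebra_simps)

lemma vector_space_scale_fps: "vector_space scale_fps"
  by standard (auto simp: scale_fps_def fun_eq_iff algebra_simps simp flip: fps_const_mult fps_const_add)

section \<open>Valuations, Hilbert function and Poincare series\<close>

text \<open>
  In what follows \<open>\<gamma> i\<close> is a normalization of the branch \<open>C i\<close>, and a subset \<open>J\<close> of the index set
  stands for the curve \<open>C\<^sub>J = (\<Union>j\<in>J. C j)\<close>. Its local ring is
  \<open>holomorphic_germs\<close> modulo \<open>vanishing_ideal (\<Union>j\<in>J. C j)\<close>; functions in \<open>holomorphic_germs\<close>
  serve as representatives. An exponent in \<open>\<int>\<^sup>J\<close> is a function on the whole index type of which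
  only the values on \<open>J\<close> matter.
\<close>

definition vanishing_ideal :: "(complex ^ 'n) set \<Rightarrow> ((complex ^ 'n) \<Rightarrow> complex) set" where
  "vanishing_ideal X = {f \<in> holomorphic_germs. \<forall>\<^sub>F z in nhds 0. z \<in> X \<longrightarrow> f z = 0}"

definition pullback :: "(complex \<Rightarrow> complex ^ 'n) \<Rightarrow> ((complex ^ 'n) \<Rightarrow> complex) \<Rightarrow> complex fps" where
  "pullback g f = fps_expansion (f \<circ> g) 0"

definition fps_ord :: "complex fps \<Rightarrow> enat" where
  "fps_ord a = (if a = 0 then \<infinity> else enat (subdegree a))"

definition val :: "(complex \<Rightarrow> complex ^ 'n) \<Rightarrow> ((complex ^ 'n) \<Rightarrow> complex) \<Rightarrow> enat" where
  "val g f = fps_ord (pullback g f)"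

text \<open>
  The preimage of \<open>\<F>(l)\<close> in \<open>holomorphic_germs\<close>. Valuations are nonnegative, so a bound \<open>l i\<close> is
  equivalent to its nonnegative part \<open>nat (l i)\<close>.
\<close>

definition val_ideal ::
    "('i \<Rightarrow> complex \<Rightarrow> complex ^ 'n) \<Rightarrow> 'i set \<Rightarrow> ('i \<Rightarrow> int) \<Rightarrow> ((complex ^ 'n) \<Rightarrow> complex) set" where
  "val_ideal \<gamma> J l = {f \<in> holomorphic_germs. \<forall>i\<in>J. enat (nat (l i)) \<le> val (\<gamma> i) f}"

text \<open>
  The vanishing ideal of \<open>C\<^sub>J\<close> is contained in \<open>val_ideal \<gamma> J l\<close> (see
  \<open>vanishing_ideal_subset_val_ideal\<close> below), so the codimension of \<open>\<F>(l)\<close> in the local ring of \<open>C\<^sub>J\<close>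
  is the codimension of its preimage.
\<close>

definition hilbert_function ::
    "('i \<Rightarrow> complex \<Rightarrow> complex ^ 'n) \<Rightarrow> 'i set \<Rightarrow> ('i \<Rightarrow> int) \<Rightarrow> enat" where
  "hilbert_function \<gamma> J l = quotient_dim scale_fun holomorphic_germs (val_ideal \<gamma> J l)"

definition poincare_coeff ::
    "('i \<Rightarrow> complex \<Rightarrow> complex ^ 'n) \<Rightarrow> 'i set \<Rightarrow> ('i \<Rightarrow> int) \<Rightarrow> int" where
  "poincare_coeff \<gamma> J l =
     (\<Sum>K\<in>Pow J. (-1) ^ (card K + 1) * int (the_enat (hilbert_function \<gamma> J (\<lambda>i. l i + of_bool (i \<in> K)))))"

text \<open>
  The one-variable series of the branch \<open>C i\<close>. No information is lost by restricting to
  nonnegative exponents, by \<open>poincare_coeff_eq_0\<close> below.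
\<close>

definition poincare_fps :: "('i \<Rightarrow> complex \<Rightarrow> complex ^ 'n) \<Rightarrow> 'i \<Rightarrow> int fps" where
  "poincare_fps \<gamma> i = Abs_fps (\<lambda>l. poincare_coeff \<gamma> {i} (\<lambda>j. if j = i then int l else 0))"

text \<open>
  The monomials occurring in a multivariate series with exponents in \<open>\<int>\<^sup>J\<close>, each exponent being
  represented by its extension by \<open>0\<close> outside \<open>J\<close>.
\<close>

definition series_support :: "'i set \<Rightarrow> (('i \<Rightarrow> int) \<Rightarrow> int) \<Rightarrow> ('i \<Rightarrow> int) set" where
  "series_support J c = {l. (\<forall>i. i \<notin> J \<longrightarrow> l i = 0) \<and> c l \<noteq> 0}"

definition is_polynomial_series :: "'i set \<Rightarrow> (('i \<Rightarrow> int) \<Rightarrow> int) \<Rightarrow> bool" where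
  "is_polynomial_series J c \<longleftrightarrow>
     finite (series_support J c) \<and> (\<forall>l\<in>series_support J c. \<forall>i\<in>J. 0 \<le> l i)"

definition series_at_one :: "'i set \<Rightarrow> (('i \<Rightarrow> int) \<Rightarrow> int) \<Rightarrow> int" where
  "series_at_one J c = (\<Sum>l\<in>series_support J c. c l)"

section \<open>Delta invariant\<close>

text \<open>
  The normalization of \<open>C\<^sub>J\<close> is the disjoint union of the normalizations of its branches, so the
  direct image of its structure sheaf at \<open>0\<close> is the product over \<open>J\<close> of copies of the ring of
  convergent power series. Elements of the product are extended by \<open>0\<close> outside \<open>J\<close>. The kernel of
  the pullback to the product is the vanishing ideal of \<open>C\<^sub>J\<close>
  (see \<open>pullback_eq_0_iff_vanishing\<close> below).
\<close>

definition normalization_ring :: "'i set \<Rightarrow> ('i \<Rightarrow> complex fps) set" where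
  "normalization_ring J = {a. (\<forall>i\<in>J. 0 < fps_conv_radius (a i)) \<and> (\<forall>i. i \<notin> J \<longrightarrow> a i = 0)}"

definition multi_pullback ::
    "('i \<Rightarrow> complex \<Rightarrow> complex ^ 'n) \<Rightarrow> 'i set \<Rightarrow> ((complex ^ 'n) \<Rightarrow> complex) \<Rightarrow> 'i \<Rightarrow> complex fps" where
  "multi_pullback \<gamma> J f = (\<lambda>i. if i \<in> J then pullback (\<gamma> i) f else 0)"

definition delta :: "('i \<Rightarrow> complex \<Rightarrow> complex ^ 'n) \<Rightarrow> 'i set \<Rightarrow> enat" where
  "delta \<gamma> J =
     quotient_dim scale_fps (normalization_ring J) (multi_pullback \<gamma> J ` holomorphic_germs)"

section \<open>Periodic constant\<close>

definition has_periodic_constant :: "int fps \<Rightarrow> real \<Rightarrow> bool" where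
  "has_periodic_constant S x \<longleftrightarrow>
     (\<exists>p>0. \<exists>Q :: real poly.
        (\<forall>\<^sub>F n in sequentially. real_of_int (\<Sum>l<p * n. fps_nth S l) = poly Q (real n)) \<and>
        x = poly Q 0)"

definition periodic_constant :: "int fps \<Rightarrow> real" where
  "periodic_constant S = (THE x. has_periodic_constant S x)"

lemma has_periodic_constant_unique:
  assumes "has_periodic_constant S x" "has_periodic_constant S y"
  shows "x = y"
proof -
  obtain p P where p: "p > 0" and x: "x = poly P 0"
    and P: "\<forall>\<^sub>F n in sequentially. real_of_int (\<Sum>l<p * n. fps_nth S l) = poly P (real n)"
    using assms(1) unfolding has_periodic_constant_def by blast
  obtain q Q where q: "q > 0" and y: "y = poly Q 0"
    and Q: "\<forall>\<^sub>F n in sequentially. real_of_int (\<Sum>l<q * n. fps_nth S l) = poly Q (real n)"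
    using assms(2) unfolding has_periodic_constant_def by blast
  obtain M N
    where M: "\<And>n. n \<ge> M \<Longrightarrow> real_of_int (\<Sum>l<p * n. fps_nth S l) = poly P (real n)"
      and N: "\<And>n. n \<ge> N \<Longrightarrow> real_of_int (\<Sum>l<q * n. fps_nth S l) = poly Q (real n)"
    using P Q unfolding eventually_sequentially by blast
  define R where "R = pcompose P [:0, real q:] - pcompose Q [:0, real p:]"
  have "poly R (real n) = 0" if "n \<ge> max M N" for n
  proof -
    have "M \<le> q * n" "N \<le> p * n"
      using that p q by (auto intro: order_trans[of _ n])
    hence "poly P (real (q * n)) = poly Q (real (p * n))"
      using M[of "q * n"] N[of "p * n"] by (simp add: mult.left_commute)
    thus ?thesis by (simp add: R_def poly_pcompose mult.commute)
  qed
  hence "real ` {max M N..} \<subseteq> {z. poly R z = 0}" by auto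
  moreover have "infinite (real ` {max M N..})"
    by (subst finite_image_iff) (auto simp: infinite_Ici)
  ultimately have "R = 0"
    using poly_roots_finite[of R] finite_subset by blast
  hence "poly R 0 = 0" by simp
  thus ?thesis by (simp add: R_def x y poly_pcompose)
qed

lemma periodic_constantI: "has_periodic_constant S x \<Longrightarrow> periodic_constant S = x"
  unfolding periodic_constant_def using has_periodic_constant_unique by blast

section \<open>Consistency of the encoding\<close>

lemma poincare_coeff_eq_0:
  assumes "finite J" "i \<in> J" "l i < 0"
  shows "poincare_coeff \<gamma> J l = 0"
proof -
  define h where "h K = int (the_enat (hilbert_function \<gamma> J (\<lambda>j. l j + of_bool (j \<in> K))))" for K
  define A where "A = J - {i}"
  have A: "finite A" "i \<notin> A" "J = insert i A" using assms by (auto simp: A_def)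
  have "val_ideal \<gamma> J (\<lambda>j. l j + of_bool (j \<in> insert i K)) =
        val_ideal \<gamma> J (\<lambda>j. l j + of_bool (j \<in> K))" for K
  proof -
    have "nat (l j + of_bool (j \<in> insert i K)) = nat (l j + of_bool (j \<in> K))" for j
      using assms(3) by (cases "j = i") (auto simp: of_bool_def)
    thus ?thesis unfolding val_ideal_def by simp
  qed
  hence h: "h (insert i K) = h K" for K by (simp add: h_def hilbert_function_def)
  have "poincare_coeff \<gamma> J l = (\<Sum>K\<in>Pow J. (-1) ^ (card K + 1) * h K)"
    by (simp add: poincare_coeff_def h_def)
  also have "\<dots> = (\<Sum>K\<in>Pow A. (-1) ^ (card K + 1) * h K) +
                  (\<Sum>K\<in>insert i ` Pow A. (-1) ^ (card K + 1) * h K)"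
    unfolding A(3) Pow_insert using A by (intro sum.union_disjoint) auto
  also have "(\<Sum>K\<in>insert i ` Pow A. (-1) ^ (card K + 1) * h K) =
             (\<Sum>K\<in>Pow A. (-1) ^ (card (insert i K) + 1) * h (insert i K))"
    using A by (subst sum.reindex) (auto simp: inj_on_def)
  also have "\<dots> = (\<Sum>K\<in>Pow A. - ((-1) ^ (card K + 1) * h K))"
  proof (intro sum.cong refl)
    fix K assume K: "K \<in> Pow A"
    hence "finite K" using A(1) finite_subset by auto
    moreover have "i \<notin> K" using K A by auto
    ultimately have "card (insert i K) = Suc (card K)" by simp
    thus "(-1) ^ (card (insert i K) + 1) * h (insert i K) = - ((-1) ^ (card K + 1) * h K)"
      by (simp add: h)
  qed
  finally show ?thesis by (simp add: sum_negf)
qed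

lemma holomorphic_germ_compose:
  fixes g :: "complex \<Rightarrow> complex ^ 'n"
  assumes f: "f \<in> holomorphic_germs" and g0: "g 0 = 0"
    and D: "open D" "0 \<in> D" "\<And>k. (\<lambda>t. g t $ k) holomorphic_on D"
  shows "\<exists>E. open E \<and> 0 \<in> E \<and> (f \<circ> g) holomorphic_on E"
proof -
  obtain U where U: "open U" "0 \<in> U" "holomorphic_cn f U"
    using f by (auto simp: holomorphic_germs_def)
  have dg: "(g has_derivative (\<lambda>h. \<chi> k. h * deriv (\<lambda>t. g t $ k) t)) (at t)" if "t \<in> D" for t
  proof (subst has_derivative_componentwise_within, intro ballI)
    fix b :: "complex ^ 'n" assume "b \<in> Basis"
    then obtain k c where b: "b = axis k c" "c \<in> Basis" by (auto simp: Basis_vec_def)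
    have "((\<lambda>t. g t $ k) has_field_derivative deriv (\<lambda>t. g t $ k) t) (at t)"
      using D that by (intro holomorphic_derivI) auto
    hence "((\<lambda>t. g t $ k) has_derivative (\<lambda>h. h * deriv (\<lambda>t. g t $ k) t)) (at t)"
      by (simp add: has_field_derivative_def mult.commute[of "deriv _ _"] mult_commute_abs)
    hence "((\<lambda>t. g t $ k \<bullet> c) has_derivative (\<lambda>h. (h * deriv (\<lambda>t. g t $ k) t) \<bullet> c)) (at t)"
      by (rule has_derivative_inner_left)
    thus "((\<lambda>x. g x \<bullet> b) has_derivative (\<lambda>x. (\<chi> k. x * deriv (\<lambda>t. g t $ k) t) \<bullet> b)) (at t)"
      by (simp add: b inner_axis)
  qed
  have cont: "continuous_on D g"
    using dg by (meson continuous_at_imp_continuous_on has_derivative_continuous)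
  define E where "E = D \<inter> g -` U"
  have "open E" unfolding E_def using cont D(1) U(1) continuous_open_preimage by blast
  moreover have "0 \<in> E" by (simp add: E_def g0 U D)
  moreover have "(f \<circ> g) holomorphic_on E"
  proof (subst holomorphic_on_open[OF \<open>open E\<close>], intro ballI)
    fix t assume t: "t \<in> E"
    obtain L where L: "(f has_derivative L) (at (g t))" "\<And>c x. L (c *s x) = c * L x"
      using U(3) t by (auto simp: E_def holomorphic_cn_def)
    define v where "v = (\<chi> k. deriv (\<lambda>t. g t $ k) t)"
    have "(f \<circ> g has_derivative (L \<circ> (\<lambda>h. \<chi> k. h * deriv (\<lambda>t. g t $ k) t))) (at t)"
      using dg[of t] L(1) t by (intro diff_chain_at) (auto simp: E_def)
    also have "(L \<circ> (\<lambda>h. \<chi> k. h * deriv (\<lambda>t. g t $ k) t)) = (\<lambda>h. L v * h)"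
    proof
      fix h
      have "(\<chi> k. h * deriv (\<lambda>t. g t $ k) t) = h *s v" by (simp add: v_def vec_eq_iff)
      thus "(L \<circ> (\<lambda>h. \<chi> k. h * deriv (\<lambda>t. g t $ k) t)) h = L v * h"
        by (simp add: L(2) mult.commute)
    qed
    finally show "\<exists>f'. ((f \<circ> g) has_field_derivative f') (at t)"
      unfolding has_field_derivative_def by blast
  qed
  ultimately show ?thesis by blast
qed

lemma pullback_eq_0_iff:
  assumes "f \<in> holomorphic_germs" "normalization g X"
  shows "pullback g f = 0 \<longleftrightarrow> (\<forall>\<^sub>F t in nhds 0. f (g t) = 0)"
proof -
  obtain D where D: "open D" "0 \<in> D" "\<And>k. (\<lambda>t. g t $ k) holomorphic_on D" "g 0 = 0"
    using assms(2) by (auto simp: normalization_def)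
  obtain E where E: "open E" "0 \<in> E" "(f \<circ> g) holomorphic_on E"
    using holomorphic_germ_compose[OF assms(1) D(4) D(1,2,3)] by blast
  have e: "(f \<circ> g) has_fps_expansion pullback g f"
    unfolding pullback_def by (rule has_fps_expansion_fps_expansion[OF E])
  show ?thesis
  proof
    assume "pullback g f = 0"
    thus "\<forall>\<^sub>F t in nhds 0. f (g t) = 0" using e by (simp add: has_fps_expansion_0_iff)
  next
    assume "\<forall>\<^sub>F t in nhds 0. f (g t) = 0"
    hence "(f \<circ> g) has_fps_expansion 0" by (simp add: has_fps_expansion_0_iff)
    thus "pullback g f = 0" using e fps_expansion_unique_complex by blast
  qed
qed

lemma normalization_eventually_iff:
  assumes "normalization g X"
  shows "(\<forall>\<^sub>F t in nhds 0. P (g t)) \<longleftrightarrow> (\<forall>\<^sub>F z in nhds 0. z \<in> X \<longrightarrow> P z)"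
proof -
  obtain D U where D: "open D" "0 \<in> D" "open U" "0 \<in> U"
      "\<And>k. (\<lambda>t. g t $ k) holomorphic_on D" "g 0 = 0" "bij_betw g D (X \<inter> U)"
      and pr: "proper_map (top_of_set D) (top_of_set (X \<inter> U)) g"
    using assms unfolding normalization_def by blast
  have gD: "g ` D = X \<inter> U" "inj_on g D" using D(7) by (auto simp: bij_betw_def)
  show ?thesis
  proof
    assume "\<forall>\<^sub>F t in nhds 0. P (g t)"
    then obtain S where S: "open S" "0 \<in> S" "\<And>t. t \<in> S \<Longrightarrow> P (g t)"
      by (auto simp: eventually_nhds)
    have "closedin (top_of_set D) (D - S)"
      using S(1) by (metis Diff_eq closed_Compl closedin_closed_Int)
    hence "closedin (top_of_set (X \<inter> U)) (g ` (D - S))"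
      using pr unfolding proper_map_def closed_map_def by blast
    then obtain T where T: "closed T" "g ` (D - S) = X \<inter> U \<inter> T"
      by (auto simp: closedin_closed)
    have "0 \<notin> g ` (D - S)"
    proof
      assume "0 \<in> g ` (D - S)"
      then obtain t where "t \<in> D - S" "g t = 0" by auto
      hence "t = 0" using inj_onD[OF gD(2), of t 0] D(2,6) by auto
      thus False using \<open>t \<in> D - S\<close> S by auto
    qed
    moreover have "0 \<in> X \<inter> U" using gD(1) D(2,6) by (metis image_eqI)
    ultimately have "0 \<notin> T" using T by auto
    hence "open (U - T)" "0 \<in> U - T" using D T by auto
    moreover have "P z" if "z \<in> U - T" "z \<in> X" for z
    proof -
      have "z \<in> g ` D" using that gD by auto
      then obtain t where t: "t \<in> D" "z = g t" by auto
      have "t \<in> S" using T that t by auto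
      thus ?thesis using S t by auto
    qed
    ultimately show "\<forall>\<^sub>F z in nhds 0. z \<in> X \<longrightarrow> P z" unfolding eventually_nhds by blast
  next
    assume ev: "\<forall>\<^sub>F z in nhds 0. z \<in> X \<longrightarrow> P z"
    have "(\<lambda>t. g t $ k) \<midarrow>0\<rightarrow> g 0 $ k" for k
      using D(1,2,5) by (metis at_within_open continuous_on_def holomorphic_on_imp_continuous_on)
    hence "g \<midarrow>0\<rightarrow> g 0" by (intro vec_tendstoI)
    hence "filterlim g (nhds 0) (nhds 0)" using D(6) unfolding tendsto_at_iff_tendsto_nhds by simp
    with ev have "\<forall>\<^sub>F t in nhds 0. g t \<in> X \<longrightarrow> P (g t)" by (rule eventually_compose_filterlim)
    moreover have "\<forall>\<^sub>F t in nhds 0. t \<in> D" using D by (intro eventually_nhds_in_open) auto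
    ultimately show "\<forall>\<^sub>F t in nhds 0. P (g t)"
      by eventually_elim (use gD in auto)
  qed
qed

lemma pullback_eq_0_iff_vanishing:
  assumes "finite J" "\<And>j. j \<in> J \<Longrightarrow> normalization (\<gamma> j) (C j)" "f \<in> holomorphic_germs"
  shows "multi_pullback \<gamma> J f = 0 \<longleftrightarrow> f \<in> vanishing_ideal (\<Union>j\<in>J. C j)"
proof -
  have "multi_pullback \<gamma> J f = 0 \<longleftrightarrow> (\<forall>j\<in>J. pullback (\<gamma> j) f = 0)"
    by (auto simp: multi_pullback_def fun_eq_iff)
  also have "\<dots> \<longleftrightarrow> (\<forall>j\<in>J. \<forall>\<^sub>F z in nhds 0. z \<in> C j \<longrightarrow> f z = 0)"
    using assms(2,3) pullback_eq_0_iff normalization_eventually_iff[of _ _ "\<lambda>z. f z = 0"]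
    by (intro ball_cong) blast+
  also have "\<dots> \<longleftrightarrow> (\<forall>\<^sub>F z in nhds 0. \<forall>j\<in>J. z \<in> C j \<longrightarrow> f z = 0)"
    by (rule eventually_ball_finite_distrib[OF assms(1), symmetric])
  finally show ?thesis using assms(3) by (auto simp: vanishing_ideal_def elim!: eventually_mono)
qed

lemma vanishing_ideal_subset_val_ideal:
  assumes "finite J" "\<And>j. j \<in> J \<Longrightarrow> normalization (\<gamma> j) (C j)"
  shows "vanishing_ideal (\<Union>j\<in>J. C j) \<subseteq> val_ideal \<gamma> J l"
proof
  fix f assume f: "f \<in> vanishing_ideal (\<Union>j\<in>J. C j)"
  hence h: "f \<in> holomorphic_germs" by (simp add: vanishing_ideal_def)
  have "multi_pullback \<gamma> J f = 0" using pullback_eq_0_iff_vanishing[OF assms h] f by simp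
  hence "pullback (\<gamma> j) f = 0" if "j \<in> J" for j
    using that by (auto simp: multi_pullback_def fun_eq_iff split: if_splits)
  thus "f \<in> val_ideal \<gamma> J l" using h by (simp add: val_ideal_def val_def fps_ord_def)
qed

end

theory Submission
  imports Defs
begin

text \<open>
  Write \<open>R\<^sub>J\<close> for the image of the local ring of \<open>C\<^sub>J\<close> in the ring \<open>N\<^sub>J\<close> of convergent power series
  on its normalization. Everything follows from one fact: \<open>R\<^sub>J\<close> has a conductor, that is, there
  is a \<open>c\<close> such that every element of \<open>N\<^sub>J\<close> whose components all have order at least \<open>c\<close> lies in
  \<open>R\<^sub>J\<close> (\<open>curve_conductor\<close>).

  For one branch the conductor is found by Lagrange interpolation. Some coordinate of the
  parametrization has finite order \<open>m\<close>, and after a change of parameter it equals \<open>s\<^sup>m\<close>. Rotating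
  the parameter by the \<open>m\<close>-th roots of unity permutes the points of the branch over a given value of
  this coordinate. As the parametrization is injective, these points are separated by further
  coordinates, and the polynomial interpolating the values of a given power series \<open>B\<close> at them,
  multiplied by its denominator, has coefficients that are invariant under the rotations, hence
  are convergent power series in \<open>s\<^sup>m\<close>. It is therefore a holomorphic function germ of the ambient
  space, and it restricts to \<open>\<Delta> * B\<close> on the branch, where the denominator \<open>\<Delta>\<close> is a nonzero power
  series not depending on \<open>B\<close> (\<open>conductor_of_curve_with_power_coordinate\<close>,
  \<open>conductor_of_injective_curve\<close>). For several branches one multiplies by equations of the other
  branches, which exist because no branch is contained in another one
  (\<open>branch_conductor_in_curve\<close>).

  The rest is dimension counting. Let \<open>h\<^sub>J\<close> be the Hilbert function of \<open>C\<^sub>J\<close>. Counting the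
  codimension in \<open>N\<^sub>J\<close> of the elements of order at least \<open>n \<ge> c\<close> in two ways gives
  \<open>\<delta>(C\<^sub>J) + h\<^sub>J(n,\<dots>,n) = n |J|\<close> (\<open>hilbert_function_plus_delta\<close>). The partial sums of the series of
  a single branch are the values \<open>h(n)\<close>, equal to \<open>n - \<delta>\<close> for \<open>n \<ge> c\<close>, so its periodic constant is
  \<open>-\<delta>\<close>. Moreover \<open>h\<^sub>J\<close> does not change in direction \<open>i\<close> as long as \<open>l\<^sub>i < 0\<close>, and it
  grows by exactly one in direction \<open>i\<close> as soon as \<open>l\<^sub>i \<ge> c\<close>
  (\<open>hilbert_function_step_above_conductor\<close>), so its mixed differences, which are the Poincare
  coefficients, vanish outside the box \<open>[0, c)\<^sup>J\<close> if \<open>|J| \<ge> 2\<close>. Summing them over this box telescopes to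
  an alternating sum of the numbers \<open>h\<^sub>K(c,\<dots>,c) = c |K| - \<delta>(C\<^sub>K)\<close> over \<open>K \<subseteq> J\<close>
  (\<open>sum_exponent_box_mixed_difference\<close>), and Moebius inversion over the subsets of \<open>I\<close> recovers
  \<open>\<delta>(C)\<close>.
\<close>

section \<open>Codimension of subspaces\<close>

text \<open>
  Bounds a sum of two suprema through the finite numbers below them, so that infinite codimensions
  need no separate treatment.
\<close>

lemma enat_add_le_if_finite_parts:
  fixes x y q :: enat
  assumes "\<And>a b. enat a \<le> x \<Longrightarrow> enat b \<le> y \<Longrightarrow> enat (a + b) \<le> q"
  shows "x + y \<le> q"
proof -
  have inf: "q = \<infinity>" if "\<And>a. enat a \<le> q"
    using that by (metis Suc_n_not_le_n enat.exhaust enat_ord_simps(1))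
  show ?thesis
  proof (cases "x = \<infinity> \<or> y = \<infinity>")
    case True
    have "enat a \<le> q" for a
      using True assms[of a 0] assms[of 0 a] by (auto simp: zero_enat_def[symmetric])
    then show ?thesis using inf by simp
  next
    case False
    then show ?thesis using assms by (metis enat.exhaust order_refl plus_enat_simps(1))
  qed
qed

context vector_space
begin

lemma quotient_dim_leI:
  assumes "\<And>B. finite B \<Longrightarrow> B \<subseteq> V \<Longrightarrow> independent B \<Longrightarrow> span B \<inter> W \<subseteq> {0} \<Longrightarrow> enat (card B) \<le> n"
  shows "quotient_dim scale V W \<le> n"
  unfolding quotient_dim_def using assms by (auto intro!: SUP_least)

lemma card_le_quotient_dim:
  assumes "finite B" "B \<subseteq> V" "independent B" "span B \<inter> W \<subseteq> {0}"
  shows "enat (card B) \<le> quotient_dim scale V W"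
  unfolding quotient_dim_def using assms by (auto intro!: SUP_upper)

text \<open>
  Passing to subsets of an independent set keeps it independent modulo \<open>W\<close>, so every natural number
  below the supremum is realized by an actual set.
\<close>

lemma quotient_dim_witness:
  assumes "enat n \<le> quotient_dim scale V W"
  obtains B where "finite B" "B \<subseteq> V" "independent B" "span B \<inter> W \<subseteq> {0}" "card B = n"
proof -
  have "\<exists>B. finite B \<and> B \<subseteq> V \<and> independent B \<and> span B \<inter> W \<subseteq> {0} \<and> n \<le> card B"
  proof (rule ccontr)
    assume *: "\<not> ?thesis"
    have "finite {}" "{} \<subseteq> V" "independent {}" "span {} \<inter> W \<subseteq> {0}"
      using independent_empty by auto
    with * have "n > 0" by (metis card.empty not_gr_zero order_refl)
    have "quotient_dim scale V W \<le> enat (n - 1)"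
    proof (rule quotient_dim_leI)
      fix B assume "finite B" "B \<subseteq> V" "independent B" "span B \<inter> W \<subseteq> {0}"
      with * have "card B < n" by (meson not_le)
      then show "enat (card B) \<le> enat (n - 1)" by simp
    qed
    from order_trans[OF assms this] \<open>n > 0\<close> show False by simp
  qed
  then obtain B where B: "finite B" "B \<subseteq> V" "independent B" "span B \<inter> W \<subseteq> {0}" "n \<le> card B"
    by blast
  obtain A where A: "A \<subseteq> B" "card A = n" "finite A"
    using obtain_subset_with_card_n[OF B(5)] by blast
  show ?thesis
    using that[of A] A B independent_mono[of B A] span_mono[of A B] by auto
qed

lemma quotient_dim_cong:
  assumes "subspace V" "V \<inter> W = V \<inter> W'"
  shows "quotient_dim scale V W = quotient_dim scale V W'"
proof -
  have "span B \<inter> W = span B \<inter> W'" if "B \<subseteq> V" for B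
    using span_minimal[OF that assms(1)] assms(2) by blast
  then show ?thesis unfolding quotient_dim_def by (intro SUP_cong) auto
qed

lemma quotient_dim_eq_0:
  assumes "V \<subseteq> W"
  shows "quotient_dim scale V W = 0"
proof -
  have "quotient_dim scale V W \<le> 0"
  proof (rule quotient_dim_leI)
    fix B assume B: "B \<subseteq> V" "independent B" "span B \<inter> W \<subseteq> {0}"
    have "B \<subseteq> {0}" using B assms span_superset[of B] by blast
    moreover have "0 \<notin> B" using B(2) dependent_zero by blast
    ultimately have "B = {}" by blast
    then show "enat (card B) \<le> 0" by (simp add: zero_enat_def)
  qed
  then show ?thesis by simp
qed

text \<open>
  A vector in both spans has one representation in terms of \<open>A \<union> B\<close>, which is supported in
  \<open>A\<close> and in \<open>B\<close>.
\<close>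

lemma span_Int_span_independent:
  assumes "independent (A \<union> B)" "A \<inter> B = {}"
  shows "span A \<inter> span B \<subseteq> {0}"
proof
  fix x assume x: "x \<in> span A \<inter> span B"
  have "representation (A \<union> B) x = representation A x"
    using x assms(1) by (intro representation_extend) auto
  moreover have "representation (A \<union> B) x = representation B x"
    using x assms(1) by (intro representation_extend) auto
  ultimately have "{b. representation A x b \<noteq> 0} = {}"
    using representation_ne_zero[of A x] representation_ne_zero[of B x] assms(2) by auto
  moreover have "independent A" using assms(1) independent_mono by blast
  ultimately show "x \<in> {0}"
    using sum_nonzero_representation_eq[of A x] x by simp
qed

lemma independent_Un_if_span_Int:
  assumes "finite A" "independent A" "independent B" "span A \<inter> span B \<subseteq> {0}"
  shows "independent (A \<union> B)"
  using assms
proof (induction A rule: finite_induct)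
  case (insert x A)
  have mono: "span A \<subseteq> span (insert x A)" by (intro span_mono) auto
  have x: "x \<notin> span A" and indA: "independent A"
    using insert.prems(1) insert.hyps by (auto simp: independent_insert)
  have "independent (A \<union> B)" using insert.IH indA insert.prems mono by blast
  moreover have "x \<notin> span (A \<union> B)"
  proof
    assume "x \<in> span (A \<union> B)"
    then obtain y z where yz: "y \<in> span A" "z \<in> span B" "x = y + z" by (auto simp: span_Un)
    have "x - y \<in> span (insert x A)"
      using yz(1) mono by (intro span_diff) (auto intro: span_base)
    then have "z = 0" using yz insert.prems(3) by auto
    then show False using yz x by simp
  qed
  ultimately show ?case by (simp add: independent_insertI)
qed simp

text \<open>
  This is additivity of dimension along \<open>(V \<inter> U) / W \<rightarrow> V / W \<rightarrow> V / (V \<inter> U)\<close>. For one inequality, a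
  basis of the part of a given span that lies in \<open>U\<close> is extended to a basis of the whole span; for
  the other, independent sets for the two outer terms are united.
\<close>

lemma quotient_dim_add:
  assumes V: "subspace V" and U: "subspace U" and W: "subspace W" and sub: "W \<subseteq> U"
  shows "quotient_dim scale V W = quotient_dim scale V U + quotient_dim scale (V \<inter> U) W"
proof (rule antisym)
  show "quotient_dim scale V W \<le> quotient_dim scale V U + quotient_dim scale (V \<inter> U) W"
  proof (rule quotient_dim_leI)
    fix B assume B: "finite B" "B \<subseteq> V" "independent B" "span B \<inter> W \<subseteq> {0}"
    obtain B2 where B2: "B2 \<subseteq> span B \<inter> U" "independent B2" "span B \<inter> U \<subseteq> span B2"
      using maximal_independent_subset[of "span B \<inter> U"] by blast
    obtain B' where B': "B2 \<subseteq> B'" "B' \<subseteq> span B" "independent B'" "span B \<subseteq> span B'"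
      using maximal_independent_subset_extend[of B2 "span B"] B2 by blast
    have "span B' = span B"
      using B'(2,4) span_minimal[OF B'(2)] by auto
    then obtain f where "bij_betw f B B'"
      using bij_if_span_eq_span_bases[OF B(3) B'(3)] by metis
    then have fin: "finite B'" and card: "card B' = card B"
      using B(1) bij_betw_finite bij_betw_same_card by metis+
    have BV: "span B \<subseteq> V" using B(2) V span_minimal by blast
    have "span (B' - B2) \<inter> U \<subseteq> {0}"
    proof -
      have "span (B' - B2) \<subseteq> span B"
        using B'(2) by (intro span_minimal) auto
      then have "span (B' - B2) \<inter> U \<subseteq> span (B' - B2) \<inter> span B2" using B2(3) by blast
      also have "\<dots> \<subseteq> {0}"
        using B' by (intro span_Int_span_independent) (auto simp: Un_absorb2)
      finally show ?thesis .
    qed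
    then have 1: "enat (card (B' - B2)) \<le> quotient_dim scale V U"
      using fin B' BV independent_mono[OF B'(3)] by (intro card_le_quotient_dim) auto
    have "span B2 \<subseteq> span B" using B2(1) by (intro span_minimal) auto
    then have 2: "enat (card B2) \<le> quotient_dim scale (V \<inter> U) W"
      using fin B' B2 BV B(4) finite_subset by (intro card_le_quotient_dim) auto
    have "card B = card (B' - B2) + card B2"
      using card B'(1) fin card_Diff_subset[of B2 B'] card_mono[of B' B2] finite_subset[of B2 B']
      by simp
    then show "enat (card B) \<le> quotient_dim scale V U + quotient_dim scale (V \<inter> U) W"
      using add_mono[OF 1 2] by simp
  qed
next
  show "quotient_dim scale V U + quotient_dim scale (V \<inter> U) W \<le> quotient_dim scale V W"
  proof (rule enat_add_le_if_finite_parts)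
    fix a b
    assume "enat a \<le> quotient_dim scale V U" "enat b \<le> quotient_dim scale (V \<inter> U) W"
    then obtain A B
      where A: "finite A" "A \<subseteq> V" "independent A" "span A \<inter> U \<subseteq> {0}" "card A = a"
        and B: "finite B" "B \<subseteq> V \<inter> U" "independent B" "span B \<inter> W \<subseteq> {0}" "card B = b"
      by (elim quotient_dim_witness)
    have BU: "span B \<subseteq> U" using B(2) U by (intro span_minimal) auto
    have AB: "span A \<inter> span B \<subseteq> {0}" using A(4) BU by blast
    have "A \<inter> B = {}"
    proof (rule ccontr)
      assume "A \<inter> B \<noteq> {}"
      then obtain x where "x \<in> A" "x \<in> B" by blast
      then have "x = 0" using AB span_base[of x A] span_base[of x B] by auto
      then show False using \<open>x \<in> A\<close> A(3) dependent_zero by blast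
    qed
    then have card: "card (A \<union> B) = a + b" using A B by (simp add: card_Un_disjoint)
    have "span (A \<union> B) \<inter> W \<subseteq> {0}"
    proof
      fix x assume x: "x \<in> span (A \<union> B) \<inter> W"
      then obtain y z where yz: "y \<in> span A" "z \<in> span B" "x = y + z" by (auto simp: span_Un)
      have "x - z \<in> U" using x yz sub BU U by (intro subspace_diff) auto
      then have "y = 0" using yz A(4) by auto
      then show "x \<in> {0}" using x yz B(4) by auto
    qed
    then have "enat (card (A \<union> B)) \<le> quotient_dim scale V W"
      using A B AB by (intro card_le_quotient_dim independent_Un_if_span_Int) auto
    then show "enat (a + b) \<le> quotient_dim scale V W" by (simp add: card)
  qed
qed

text \<open>
  A linear functional identifies the quotient by its kernel with its image, a subspace of the line.
\<close>

lemma quotient_dim_functional_kernel: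
  fixes \<phi> :: "'b \<Rightarrow> 'a"
  assumes V: "subspace V"
    and add: "\<And>x y. x \<in> V \<Longrightarrow> y \<in> V \<Longrightarrow> \<phi> (x + y) = \<phi> x + \<phi> y"
    and scale: "\<And>c x. x \<in> V \<Longrightarrow> \<phi> (scale c x) = c * \<phi> x"
    and W: "\<And>x. x \<in> V \<Longrightarrow> x \<in> W \<longleftrightarrow> \<phi> x = 0"
  shows "quotient_dim scale V W = of_bool (\<exists>x\<in>V. \<phi> x \<noteq> 0)"
proof (cases "\<exists>x\<in>V. \<phi> x \<noteq> 0")
  case False
  then show ?thesis using W by (simp add: quotient_dim_eq_0 subset_iff)
next
  case True
  then obtain v where v: "v \<in> V" "\<phi> v \<noteq> 0" by blast
  have "quotient_dim scale V W \<le> 1"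
  proof (rule quotient_dim_leI)
    fix B assume B: "finite B" "B \<subseteq> V" "independent B" "span B \<inter> W \<subseteq> {0}"
    have BV: "span B \<subseteq> V" using B(2) V span_minimal by blast
    have "x = y" if xy: "x \<in> B" "y \<in> B" for x y
    proof (rule ccontr)
      assume ne: "x \<noteq> y"
      have x0: "x \<noteq> 0" using B(3) xy dependent_zero by blast
      then have "x \<notin> W" using B(4) xy span_base[of x B] by blast
      then have px: "\<phi> x \<noteq> 0" using W xy B(2) by auto
      \<comment> \<open>Two distinct vectors always have a nontrivial combination in the kernel.\<close>
      let ?w = "scale (\<phi> x) y + scale (- \<phi> y) x"
      have w: "?w \<in> span B" using xy by (intro span_add span_scale span_base)
      have "\<phi> ?w = 0"
      proof -
        have "x \<in> V" "y \<in> V" using xy B(2) by auto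
        moreover from this have "scale (\<phi> x) y \<in> V" "scale (- \<phi> y) x \<in> V"
          using V subspace_scale by blast+
        ultimately show ?thesis
          using add scale[of x "- \<phi> y"] scale[of y "\<phi> x"] by (simp del: scale_minus_left)
      qed
      then have "?w = 0" using w B(4) W BV by blast
      then have "scale (\<phi> x) y = scale (\<phi> y) x" by simp
      then have "y = scale (\<phi> y / \<phi> x) x"
        
      proof -
        have "scale (inverse (\<phi> x)) (scale (\<phi> x) y) = scale (inverse (\<phi> x)) (scale (\<phi> y) x)"
          using \<open>scale (\<phi> x) y = scale (\<phi> y) x\<close> by (rule arg_cong)
        then show ?thesis using px by (simp add: field_simps)
      qed
      moreover have "x \<in> span (B - {y})" using xy ne by (auto intro: span_base)
      ultimately have "y \<in> span (B - {y})" by (metis span_scale)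
      then show False using B(3) xy by (auto simp: dependent_def)
    qed
    then have "card B \<le> Suc 0" using B(1) card_le_Suc0_iff_eq by blast
    then show "enat (card B) \<le> 1" by (simp add: one_enat_def)
  qed
  moreover have "1 \<le> quotient_dim scale V W"
  proof -
    have "v \<noteq> 0"
      using scale[OF v(1), of 0] v by auto
    have "span {v} \<inter> W \<subseteq> {0}"
    proof
      fix x assume x: "x \<in> span {v} \<inter> W"
      then obtain c where c: "x = scale c v" by (auto simp: span_singleton)
      have "x \<in> V" using c v V subspace_scale by blast
      then have "c * \<phi> v = 0" using W x scale[OF v(1), of c] c by auto
      then show "x \<in> {0}" using v c by simp
    qed
    then have "enat (card {v}) \<le> quotient_dim scale V W"
      using v \<open>v \<noteq> 0\<close> by (intro card_le_quotient_dim) auto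
    then show ?thesis by (simp add: one_enat_def)
  qed
  ultimately show ?thesis using True by simp
qed

end

context vector_space_pair
begin

lemma quotient_dim_image_linear:
  assumes f: "Vector_Spaces.linear s1 s2 f" and V: "vs1.subspace V" and W: "0 \<in> W"
  shows "quotient_dim s1 V {x \<in> V. f x \<in> W} = quotient_dim s2 (f ` V) W"
proof (rule antisym)
  interpret lf: Vector_Spaces.linear s1 s2 f by fact
  show "quotient_dim s1 V {x \<in> V. f x \<in> W} \<le> quotient_dim s2 (f ` V) W"
  proof (rule vs1.quotient_dim_leI)
    fix B assume B: "finite B" "B \<subseteq> V" "vs1.independent B" "vs1.span B \<inter> {x \<in> V. f x \<in> W} \<subseteq> {0}"
    have BV: "vs1.span B \<subseteq> V" using B(2) V vs1.span_minimal by blast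
    have inj: "inj_on f (vs1.span B)"
      using B(4) BV W by (subst lf.inj_on_iff_eq_0) auto
    then have "inj_on f B" using inj_on_subset vs1.span_superset by blast
    have "vs2.independent (f ` B)" using lf.independent_injective_image B(3) inj by blast
    moreover have "vs2.span (f ` B) \<inter> W \<subseteq> {0}"
      using B(4) BV by (auto simp: lf.span_image)
    ultimately have "enat (card (f ` B)) \<le> quotient_dim s2 (f ` V) W"
      using B by (intro vs2.card_le_quotient_dim) auto
    then show "enat (card B) \<le> quotient_dim s2 (f ` V) W"
      using \<open>inj_on f B\<close> by (simp add: card_image)
  qed
next
  interpret lf: Vector_Spaces.linear s1 s2 f by fact
  show "quotient_dim s2 (f ` V) W \<le> quotient_dim s1 V {x \<in> V. f x \<in> W}"
  proof (rule vs2.quotient_dim_leI)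
    fix B assume B: "finite B" "B \<subseteq> f ` V" "vs2.independent B" "vs2.span B \<inter> W \<subseteq> {0}"
    obtain A where A: "A \<subseteq> V" "inj_on f A" "f ` A = B"
      using B(2) by (metis subset_image_inj)
    have "vs1.independent A"
    proof
      assume "vs1.dependent A"
      then obtain a where a: "a \<in> A" "a \<in> vs1.span (A - {a})" by (auto simp: vs1.dependent_def)
      have "f a \<in> vs2.span (f ` (A - {a}))"
        using a(2) by (simp add: lf.span_image)
      also have "f ` (A - {a}) = B - {f a}"
        using A(2,3) a(1) by (auto simp: inj_on_def)
      finally show False
        using B(3) A(3) a(1) by (auto simp: vs2.dependent_def)
    qed
    have inj: "inj_on f (vs1.span A)"
      using lf.inj_on_span_independent_image[of A] A B(3) by simp
    have "vs1.span A \<inter> {x \<in> V. f x \<in> W} \<subseteq> {0}"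
    proof
      fix x assume x: "x \<in> vs1.span A \<inter> {x \<in> V. f x \<in> W}"
      then have "f x \<in> vs2.span B" using lf.span_image[of A] A(3) by auto
      then have "f x = 0" using x B(4) by auto
      then show "x \<in> {0}" using inj x lf.inj_on_iff_eq_0[OF vs1.subspace_span, of A] by auto
    qed
    moreover have "finite A" "card A = card B" using A B(1) finite_image_iff card_image by metis+
    ultimately show "enat (card B) \<le> quotient_dim s1 V {x \<in> V. f x \<in> W}"
      using A \<open>vs1.independent A\<close> vs1.card_le_quotient_dim by metis
  qed
qed

text \<open>
  This is applied to the pullback of functions to power series, which is linear on the holomorphic
  germs but not on the ambient space of all functions. The proof replaces \<open>f\<close> by a linear
  map that agrees with it on a basis of \<open>V\<close>.
\<close>

lemma quotient_dim_image:
  assumes V: "vs1.subspace V" and W: "0 \<in> W"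
    and add: "\<And>x y. x \<in> V \<Longrightarrow> y \<in> V \<Longrightarrow> f (x + y) = f x + f y"
    and scale: "\<And>c x. x \<in> V \<Longrightarrow> f (s1 c x) = s2 c (f x)"
  shows "quotient_dim s1 V {x \<in> V. f x \<in> W} = quotient_dim s2 (f ` V) W"
proof -
  obtain B where B: "B \<subseteq> V" "vs1.independent B" "V \<subseteq> vs1.span B"
    using vs1.maximal_independent_subset[of V] by blast
  define F where "F = construct B f"
  interpret lf: Vector_Spaces.linear s1 s2 F
    unfolding F_def by (rule linear_construct[OF B(2)])
  have BV: "vs1.span B \<subseteq> V" using B(1) V vs1.span_minimal by blast
  have "x \<in> V \<and> f x = F x" if "x \<in> vs1.span B" for x
    using that
  proof (induction rule: vs1.span_induct_alt)
    case base
    have "0 \<in> V" using V vs1.subspace_0 by blast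
    then show ?case using scale[of 0 0] by (simp add: lf.zero)
  next
    case (step c x y)
    then have "x \<in> V" "f x = F x" using B by (auto simp: F_def construct_basis)
    then show ?case
      using step V by (auto simp: add scale lf.add lf.scale vs1.subspace_scale vs1.subspace_add)
  qed
  then have eq: "f x = F x" if "x \<in> V" for x using that B(3) by auto
  have "quotient_dim s1 V {x \<in> V. F x \<in> W} = quotient_dim s2 (F ` V) W"
    by (rule quotient_dim_image_linear[OF _ V W]) unfold_locales
  moreover have "{x \<in> V. F x \<in> W} = {x \<in> V. f x \<in> W}" "F ` V = f ` V"
    using eq by (auto simp: image_iff)
  ultimately show ?thesis by simp
qed

end

section \<open>The conductor of a parametrized branch\<close>

text \<open>
  The function germs needed to realize a conductor are polynomials in the coordinates with
  coefficients that are convergent power series in one coordinate.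
\<close>

lemma holomorphic_germs_const: "(\<lambda>z. c) \<in> holomorphic_germs"
  unfolding holomorphic_germs_def holomorphic_cn_def
  by (auto intro!: exI[of _ UNIV] exI[of _ "\<lambda>_. 0"])

lemma holomorphic_germs_add:
  assumes "f \<in> holomorphic_germs" "g \<in> holomorphic_germs"
  shows "(\<lambda>z. f z + g z) \<in> holomorphic_germs"
proof -
  obtain U V where U: "open U" "0 \<in> U" "holomorphic_cn f U" and V: "open V" "0 \<in> V" "holomorphic_cn g V"
    using assms by (auto simp: holomorphic_germs_def)
  have "\<exists>L. ((\<lambda>z. f z + g z) has_derivative L) (at z) \<and> (\<forall>c x. L (c *s x) = c * L x)"
    if z: "z \<in> U \<inter> V" for z
  proof -
    obtain L M where "(f has_derivative L) (at z)" "\<forall>c x. L (c *s x) = c * L x"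
        "(g has_derivative M) (at z)" "\<forall>c x. M (c *s x) = c * M x"
      using U(3) V(3) z unfolding holomorphic_cn_def by blast
    then show ?thesis
      by (intro exI[of _ "\<lambda>h. L h + M h"]) (auto intro: has_derivative_add simp: distrib_left)
  qed
  then show ?thesis
    unfolding holomorphic_germs_def holomorphic_cn_def using U V
    by (auto intro!: exI[of _ "U \<inter> V"])
qed

lemma holomorphic_germs_mult:
  assumes "f \<in> holomorphic_germs" "g \<in> holomorphic_germs"
  shows "(\<lambda>z. f z * g z) \<in> holomorphic_germs"
proof -
  obtain U V where U: "open U" "0 \<in> U" "holomorphic_cn f U" and V: "open V" "0 \<in> V" "holomorphic_cn g V"
    using assms by (auto simp: holomorphic_germs_def)
  have "\<exists>L. ((\<lambda>z. f z * g z) has_derivative L) (at z) \<and> (\<forall>c x. L (c *s x) = c * L x)"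
    if z: "z \<in> U \<inter> V" for z
  proof -
    obtain L M where "(f has_derivative L) (at z)" "\<forall>c x. L (c *s x) = c * L x"
        "(g has_derivative M) (at z)" "\<forall>c x. M (c *s x) = c * M x"
      using U(3) V(3) z unfolding holomorphic_cn_def by blast
    moreover from this have "((\<lambda>z. f z * g z) has_derivative (\<lambda>h. f z * M h + L h * g z)) (at z)"
      by (intro has_derivative_mult)
    ultimately show ?thesis
      by (intro exI[of _ "\<lambda>h. f z * M h + L h * g z"]) (simp add: distrib_left mult_ac)
  qed
  then show ?thesis
    unfolding holomorphic_germs_def holomorphic_cn_def using U V
    by (auto intro!: exI[of _ "U \<inter> V"])
qed

lemma holomorphic_germs_sum:
  "(\<And>a. a \<in> A \<Longrightarrow> f a \<in> holomorphic_germs) \<Longrightarrow> (\<lambda>z. \<Sum>a\<in>A. f a z) \<in> holomorphic_germs"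
  by (induction A rule: infinite_finite_induct)
    (auto intro: holomorphic_germs_const holomorphic_germs_add)

lemma holomorphic_germs_prod:
  "(\<And>a. a \<in> A \<Longrightarrow> f a \<in> holomorphic_germs) \<Longrightarrow> (\<lambda>z. \<Prod>a\<in>A. f a z) \<in> holomorphic_germs"
  by (induction A rule: infinite_finite_induct)
    (auto intro: holomorphic_germs_const holomorphic_germs_mult)

lemma holomorphic_germs_compose_coordinate:
  fixes k :: "'n :: finite"
  assumes "p analytic_on {0}"
  shows "(\<lambda>z :: complex ^ 'n. p (z $ k)) \<in> holomorphic_germs"
proof -
  obtain E where E: "open E" "0 \<in> E" "p holomorphic_on E"
    using assms by (auto simp: analytic_at)
  define U where "U = {z :: complex ^ 'n. z $ k \<in> E}"
  have U: "open U" "0 \<in> U"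
    using open_vimage_vec_nth[OF E(1), of k] E(2) by (auto simp: U_def vimage_def)
  have "\<exists>L. ((\<lambda>z. p (z $ k)) has_derivative L) (at z) \<and> (\<forall>c x. L (c *s x) = c * L x)"
    if "z \<in> U" for z
  proof -
    have "(p has_field_derivative deriv p (z $ k)) (at (z $ k))"
      using E that by (intro holomorphic_derivI[of _ E]) (auto simp: U_def)
    then have "((\<lambda>z. p (z $ k)) has_derivative (\<lambda>h. deriv p (z $ k) * (h $ k))) (at z)"
      unfolding has_field_derivative_def
      by (rule has_derivative_compose[rotated])
        (rule bounded_linear.has_derivative[OF bounded_linear_vec_nth has_derivative_ident])
    then show ?thesis
      by (intro exI conjI) auto
  qed
  then show ?thesis
    unfolding holomorphic_germs_def holomorphic_cn_def using U by auto
qed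

lemma holomorphic_germs_coordinate: "(\<lambda>z. z $ k) \<in> holomorphic_germs"
  using holomorphic_germs_compose_coordinate[of "\<lambda>x. x"] by (simp add: analytic_on_ident)

text \<open>
  Multiplication by a primitive root \<open>\<xi>\<close> permutes the roots of unity and multiplies the sum by
  \<open>\<xi> ^ n \<noteq> 1\<close>.
\<close>

lemma sum_power_roots_of_unity:
  assumes "m > 0" "\<not> m dvd n"
  shows "(\<Sum>\<zeta> | \<zeta> ^ m = 1. \<zeta> ^ n) = (0 :: complex)"
proof -
  define \<xi> where "\<xi> = exp (2 * of_real pi * \<i> * of_nat 1 / of_nat m)"
  have pow: "\<xi> ^ j = exp (2 * of_real pi * \<i> * of_nat j / of_nat m)" for j
    by (simp add: \<xi>_def exp_of_nat_mult[symmetric] field_simps)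
  have "\<xi> ^ m = 1" "\<xi> ^ n \<noteq> 1"
    unfolding pow using assms complex_root_unity_eq_1[of m] by auto
  have "\<xi> \<noteq> 0" by (simp add: \<xi>_def)
  have "(\<Sum>\<zeta> | \<zeta> ^ m = 1. \<zeta> ^ n) = (\<Sum>\<zeta> | \<zeta> ^ m = 1. (\<xi> * \<zeta>) ^ n)"
    by (rule sum.reindex_bij_witness[of _ "\<lambda>\<zeta>. \<xi> * \<zeta>" "\<lambda>\<zeta>. \<zeta> / \<xi>"])
      (use \<open>\<xi> ^ m = 1\<close> \<open>\<xi> \<noteq> 0\<close> in \<open>auto simp: power_mult_distrib power_divide\<close>)
  also have "\<dots> = \<xi> ^ n * (\<Sum>\<zeta> | \<zeta> ^ m = 1. \<zeta> ^ n)"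
    by (simp add: power_mult_distrib sum_distrib_left)
  finally show ?thesis using \<open>\<xi> ^ n \<noteq> 1\<close> by simp
qed

text \<open>
  Up to a factor \<open>m\<close>, summing over the rotations keeps exactly the monomials \<open>s ^ n\<close> with \<open>m dvd n\<close>.
\<close>

lemma sum_over_rotations_is_series_in_power:
  assumes \<psi>: "\<psi> analytic_on {0}" and m: "m > 0"
  shows "\<exists>p. p analytic_on {0} \<and> (\<forall>\<^sub>F s in nhds 0. (\<Sum>\<zeta> | \<zeta> ^ m = 1. \<psi> (\<zeta> * s)) = p (s ^ m))"
proof -
  obtain F where F: "\<psi> has_fps_expansion F"
    using analytic_at_imp_has_fps_expansion_0[OF \<psi>] by blast
  define H where "H = (\<Sum>\<zeta> | \<zeta> ^ m = 1. F oo (fps_const \<zeta> * fps_X))"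
  have "(\<lambda>s. \<Sum>\<zeta> | \<zeta> ^ m = 1. (\<psi> \<circ> (\<lambda>s. \<zeta> * s)) s) has_fps_expansion H"
    unfolding H_def
    by (intro has_fps_expansion_sum has_fps_expansion_compose F)
      (auto intro!: fps_expansion_intros)
  then have rad: "fps_conv_radius H > 0"
    and ev: "\<forall>\<^sub>F s in nhds 0. eval_fps H s = (\<Sum>\<zeta> | \<zeta> ^ m = 1. \<psi> (\<zeta> * s))"
    by (auto simp: has_fps_expansion_def)
  have nth: "fps_nth H n = (\<Sum>\<zeta> | \<zeta> ^ m = 1. \<zeta> ^ n) * fps_nth F n" for n
    by (simp add: H_def fps_sum_nth fps_compose_linear sum_distrib_right)
  define P where "P = Abs_fps (\<lambda>j. fps_nth H (m * j))"
  have mono: "strict_mono (\<lambda>j. m * j)" using m by (auto simp: strict_mono_def)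
  have zero: "fps_nth H n * s ^ n = 0" if "n \<notin> range (\<lambda>j. m * j)" for n and s :: complex
    using that m sum_power_roots_of_unity[of m n] by (auto simp: nth dvd_def)
  have eval: "eval_fps P (s ^ m) = eval_fps H s" for s
    using suminf_mono_reindex[OF mono, of "\<lambda>n. fps_nth H n * s ^ n"] zero
    by (simp add: eval_fps_def P_def power_mult)
  \<comment> \<open>The subseries converges wherever the full series does.\<close>
  obtain x :: real where x: "0 < x" "ereal x < fps_conv_radius H"
    using rad by (metis ereal_dense2 zero_ereal_def ereal_less(2))
  have "summable (\<lambda>n. fps_nth H n * complex_of_real x ^ n)"
    using x by (intro summable_fps) auto
  then have "summable (\<lambda>j. fps_nth P j * (complex_of_real x ^ m) ^ j)"
    using summable_mono_reindex[OF mono, of "\<lambda>n. fps_nth H n * complex_of_real x ^ n"] zero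
    by (simp add: P_def power_mult)
  then have "ereal (norm (complex_of_real x ^ m)) \<le> fps_conv_radius P"
    unfolding fps_conv_radius_def by (rule conv_radius_geI)
  moreover have "norm (complex_of_real x ^ m) > 0" using x by simp
  ultimately have "fps_conv_radius P > 0" by (metis ereal_less(2) less_le_trans)
  then have "eval_fps P analytic_on {0}"
    using has_fps_expansion_imp_analytic_0 eval_fps_has_fps_expansion by blast
  moreover have "\<forall>\<^sub>F s in nhds 0. (\<Sum>\<zeta> | \<zeta> ^ m = 1. \<psi> (\<zeta> * s)) = eval_fps P (s ^ m)"
    using ev by eventually_elim (simp add: eval)
  ultimately show ?thesis by blast
qed

lemma prod_analytic_not_eventually_zero:
  assumes "\<And>a. a \<in> A \<Longrightarrow> f a analytic_on {0}"
    and "\<And>a. a \<in> A \<Longrightarrow> \<not> (\<forall>\<^sub>F s in nhds 0. f a s = 0)"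
  shows "\<not> (\<forall>\<^sub>F s in nhds (0 :: complex). (\<Prod>a\<in>A. f a s) = (0 :: complex))"
proof (cases "finite A")
  case True
  have "\<exists>F. f a has_fps_expansion F \<and> F \<noteq> 0" if "a \<in> A" for a
    using analytic_at_imp_has_fps_expansion_0[OF assms(1)[OF that]] assms(2)[OF that]
      has_fps_expansion_0_iff by metis
  then obtain F where F: "\<And>a. a \<in> A \<Longrightarrow> f a has_fps_expansion F a" "\<And>a. a \<in> A \<Longrightarrow> F a \<noteq> 0"
    by metis
  have e: "(\<lambda>s. \<Prod>a\<in>A. f a s) has_fps_expansion (\<Prod>a\<in>A. F a)"
    by (intro has_fps_expansion_prod F)
  show ?thesis
  proof
    assume "\<forall>\<^sub>F s in nhds 0. (\<Prod>a\<in>A. f a s) = 0"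
    then have "(\<lambda>s. \<Prod>a\<in>A. f a s) has_fps_expansion 0" by (simp add: has_fps_expansion_0_iff)
    with e have "(\<Prod>a\<in>A. F a) = 0" using fps_expansion_unique_complex by blast
    then show False using F(2) True by auto
  qed
qed auto

text \<open>
  Lagrange interpolation over the \<open>m\<close> points \<open>G (\<zeta> * s)\<close>, \<open>\<zeta> ^ m = 1\<close>, on which the coordinate \<open>k0\<close>
  takes the common value \<open>s ^ m\<close>. By injectivity every root of unity \<open>\<eta> \<noteq> 1\<close> has a coordinate \<open>\<kappa> \<eta>\<close> in which
  \<open>G s\<close> and \<open>G (\<eta> * s)\<close> differ. The interpolating function is
  \<open>(\<Sum>\<zeta>. B (\<zeta> * s) * (\<Prod>\<eta>\<noteq>1. z $ \<kappa> \<eta> - G (\<eta> * \<zeta> * s) $ \<kappa> \<eta>))\<close>.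
  Since the coordinate chosen in a factor depends only on the ratio \<open>\<eta>\<close> of the two rotations, rotating \<open>s\<close>
  merely permutes the summands. Expanding the products, the coefficient of each monomial in \<open>z\<close> is thus a sum over
  rotations, hence a power series in \<open>s ^ m\<close>, which is the coordinate \<open>k0\<close>. At \<open>z = G s\<close> only the
  summand for \<open>\<zeta> = 1\<close> survives, because for \<open>\<zeta> \<noteq> 1\<close> the factor with \<open>\<eta> = inverse \<zeta>\<close> vanishes.
\<close>

lemma conductor_of_curve_with_power_coordinate:
  fixes G :: "complex \<Rightarrow> complex ^ 'n"
  assumes G: "\<And>k. (\<lambda>s. G s $ k) analytic_on {0}"
    and r: "r > 0" "inj_on G (ball 0 r)" "\<And>s. s \<in> ball 0 r \<Longrightarrow> G s $ k0 = s ^ m"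
    and m: "m > 0"
  shows "\<exists>\<Delta>. \<Delta> analytic_on {0} \<and> \<not> (\<forall>\<^sub>F s in nhds 0. \<Delta> s = 0) \<and>
           (\<forall>B. B analytic_on {0} \<longrightarrow>
             (\<exists>f\<in>holomorphic_germs. \<forall>\<^sub>F s in nhds 0. f (G s) = \<Delta> s * B s))"
proof -
  define R where "R = {\<zeta> :: complex. \<zeta> ^ m = 1}"
  define E where "E = R - {1}"
  have finR: "finite R" and finE: "finite E"
    using finite_roots_unity[of m] m by (auto simp: R_def E_def)
  have norm1: "norm \<zeta> = 1" if "\<zeta> \<in> R" for \<zeta>
  proof -
    have "norm \<zeta> ^ m = 1 ^ m" using norm_power[of \<zeta> m] that by (simp add: R_def)
    then show ?thesis using power_eq_imp_eq_base[of "norm \<zeta>" m 1] m by simp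
  qed
  have rot: "(\<lambda>s. G (\<zeta> * s) $ k) analytic_on {0}" for \<zeta> k
  proof -
    have "(\<lambda>s. G s $ k) \<circ> (\<lambda>s. \<zeta> * s) analytic_on {0}"
      using G by (intro analytic_on_compose) (auto intro!: analytic_intros)
    then show ?thesis by (simp add: o_def)
  qed
  have "\<exists>k. \<not> (\<forall>\<^sub>F s in nhds 0. G s $ k - G (\<eta> * s) $ k = 0)" if \<eta>: "\<eta> \<in> E" for \<eta>
  proof (rule ccontr)
    assume "\<not> ?thesis"
    then have "\<forall>\<^sub>F s in nhds 0. \<forall>k\<in>UNIV. G s $ k - G (\<eta> * s) $ k = 0"
      by (intro eventually_ball_finite) auto
    then have "\<forall>\<^sub>F s in nhds 0. G s = G (\<eta> * s)"
      by eventually_elim (simp add: vec_eq_iff)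
    moreover have "\<forall>\<^sub>F s in nhds 0. s \<in> ball 0 r"
      using r(1) by (intro eventually_nhds_in_open) auto
    ultimately have "\<forall>\<^sub>F s in at 0. s \<noteq> 0 \<and> G s = G (\<eta> * s) \<and> s \<in> ball 0 r"
      unfolding eventually_at_filter by eventually_elim auto
    then obtain s where s: "s \<noteq> 0" "G s = G (\<eta> * s)" "s \<in> ball 0 r"
      using eventually_happens'[OF at_neq_bot] by blast
    then have "s = \<eta> * s"
      using norm1[of \<eta>] \<eta> by (intro inj_onD[OF r(2)]) (auto simp: E_def norm_mult)
    then show False using s(1) \<eta> by (auto simp: E_def)
  qed
  then obtain \<kappa> where \<kappa>: "\<And>\<eta>. \<eta> \<in> E \<Longrightarrow> \<not> (\<forall>\<^sub>F s in nhds 0. G s $ \<kappa> \<eta> - G (\<eta> * s) $ \<kappa> \<eta> = 0)"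
    by metis
  define \<Delta> where "\<Delta> s = (\<Prod>\<eta>\<in>E. G s $ \<kappa> \<eta> - G (\<eta> * s) $ \<kappa> \<eta>)" for s
  have factor: "(\<lambda>s. G s $ \<kappa> \<eta> - G (\<eta> * s) $ \<kappa> \<eta>) analytic_on {0}" for \<eta>
    by (intro analytic_on_diff G rot)
  have "\<Delta> analytic_on {0}"
    unfolding \<Delta>_def by (intro analytic_on_prod factor)
  moreover have "\<not> (\<forall>\<^sub>F s in nhds 0. \<Delta> s = 0)"
    unfolding \<Delta>_def by (rule prod_analytic_not_eventually_zero[OF factor \<kappa>])
  moreover have "\<exists>f\<in>holomorphic_germs. \<forall>\<^sub>F s in nhds 0. f (G s) = \<Delta> s * B s"
    if B: "B analytic_on {0}" for B
  proof -
    \<comment> \<open>\<open>\<psi> A\<close> yields the coefficient of the monomial with factors \<open>z $ \<kappa> \<eta>\<close> for \<open>\<eta> \<in> A\<close>; \<open>p A\<close> is this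
      coefficient as a series in \<open>s ^ m\<close>.\<close>
    define \<psi> where "\<psi> A s = B s * (\<Prod>\<eta>\<in>E - A. - (G (\<eta> * s) $ \<kappa> \<eta>))" for A s
    have "\<exists>p. p analytic_on {0} \<and> (\<forall>\<^sub>F s in nhds 0. (\<Sum>\<zeta>\<in>R. \<psi> A (\<zeta> * s)) = p (s ^ m))" for A
      unfolding R_def
      by (rule sum_over_rotations_is_series_in_power[OF _ m])
        (auto simp: \<psi>_def intro!: analytic_on_mult B analytic_on_prod analytic_on_neg rot)
    then obtain p where p: "\<And>A. p A analytic_on {0}"
      "\<And>A. \<forall>\<^sub>F s in nhds 0. (\<Sum>\<zeta>\<in>R. \<psi> A (\<zeta> * s)) = p A (s ^ m)"
      by metis
    define f where "f z = (\<Sum>A\<in>Pow E. (\<Prod>\<eta>\<in>A. z $ \<kappa> \<eta>) * p A (z $ k0))" for z :: "complex ^ 'n"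
    have "f \<in> holomorphic_germs"
      unfolding f_def using p(1)
      by (intro holomorphic_germs_sum holomorphic_germs_mult holomorphic_germs_prod
          holomorphic_germs_coordinate holomorphic_germs_compose_coordinate)
    moreover have "\<forall>\<^sub>F s in nhds 0. f (G s) = \<Delta> s * B s"
    proof -
      have "\<forall>\<^sub>F s in nhds 0. s \<in> ball 0 r"
        using r(1) by (intro eventually_nhds_in_open) auto
      moreover have "\<forall>\<^sub>F s in nhds 0. \<forall>A\<in>Pow E. (\<Sum>\<zeta>\<in>R. \<psi> A (\<zeta> * s)) = p A (s ^ m)"
        using p(2) finE by (intro eventually_ball_finite) auto
      ultimately show ?thesis
      proof eventually_elim
        case (elim s)
        define L where "L \<zeta> = (\<Prod>\<eta>\<in>E. G s $ \<kappa> \<eta> - G (\<eta> * (\<zeta> * s)) $ \<kappa> \<eta>)" for \<zeta>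
        have "f (G s) = (\<Sum>A\<in>Pow E. (\<Prod>\<eta>\<in>A. G s $ \<kappa> \<eta>) * (\<Sum>\<zeta>\<in>R. \<psi> A (\<zeta> * s)))"
          using elim r(3) by (auto simp: f_def intro!: sum.cong)
        also have "\<dots> = (\<Sum>\<zeta>\<in>R. \<Sum>A\<in>Pow E. (\<Prod>\<eta>\<in>A. G s $ \<kappa> \<eta>) * \<psi> A (\<zeta> * s))"
          by (subst sum.swap) (simp add: sum_distrib_left)
        also have "\<dots> = (\<Sum>\<zeta>\<in>R. B (\<zeta> * s) * L \<zeta>)"
        proof (intro sum.cong refl)
          fix \<zeta>
          have "L \<zeta> = (\<Prod>\<eta>\<in>E. G s $ \<kappa> \<eta> + - (G (\<eta> * (\<zeta> * s)) $ \<kappa> \<eta>))"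
            by (simp add: L_def)
          also have "\<dots> = (\<Sum>A\<in>Pow E. (\<Prod>\<eta>\<in>A. G s $ \<kappa> \<eta>) * (\<Prod>\<eta>\<in>E - A. - (G (\<eta> * (\<zeta> * s)) $ \<kappa> \<eta>)))"
            by (rule prod_add[OF finE])
          finally show "(\<Sum>A\<in>Pow E. (\<Prod>\<eta>\<in>A. G s $ \<kappa> \<eta>) * \<psi> A (\<zeta> * s)) = B (\<zeta> * s) * L \<zeta>"
            by (simp add: \<psi>_def sum_distrib_left mult_ac)
        qed
        also have "\<dots> = (\<Sum>\<zeta>\<in>{1}. B (\<zeta> * s) * L \<zeta>)"
        proof (intro sum.mono_neutral_right ballI)
          fix \<zeta> assume \<zeta>: "\<zeta> \<in> R - {1}"
          then have "\<zeta> \<noteq> 0" using m by (auto simp: R_def zero_power)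
          then have "inverse \<zeta> \<in> E" "inverse \<zeta> * (\<zeta> * s) = s"
            using \<zeta> by (auto simp: E_def R_def power_inverse)
          then have "L \<zeta> = 0"
            using finE unfolding L_def by (intro prod_zero bexI[of _ "inverse \<zeta>"]) (simp_all only: diff_self)
          then show "B (\<zeta> * s) * L \<zeta> = 0" by simp
        qed (use finR in \<open>auto simp: R_def\<close>)
        also have "\<dots> = \<Delta> s * B s" by (simp add: L_def \<Delta>_def)
        finally show ?case .
      qed
    qed
    ultimately show ?thesis by blast
  qed
  ultimately show ?thesis by blast
qed

text \<open>
  The general case reduces to the previous one: a coordinate of order \<open>m\<close> has the form \<open>\<phi> ^ m\<close> for a
  local coordinate \<open>\<phi>\<close> of the complex line, and the conclusion is invariant under the change of
  parameter \<open>s = \<phi> t\<close> with inverse \<open>u\<close>.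
\<close>

lemma conductor_of_injective_curve:
  fixes g :: "complex \<Rightarrow> complex ^ 'n"
  assumes g: "\<And>k. (\<lambda>t. g t $ k) holomorphic_on S" and S: "open S" "0 \<in> S"
    and g0: "g 0 = 0" and inj: "inj_on g S"
  shows "\<exists>\<Delta>. \<Delta> analytic_on {0} \<and> \<not> (\<forall>\<^sub>F t in nhds 0. \<Delta> t = 0) \<and>
           (\<forall>B. B analytic_on {0} \<longrightarrow>
             (\<exists>f\<in>holomorphic_germs. \<forall>\<^sub>F t in nhds 0. f (g t) = \<Delta> t * B t))"
proof -
  obtain e where e: "e > 0" "ball 0 e \<subseteq> S" using S openE by blast
  define t0 where "t0 = complex_of_real (e / 2)"
  have t0: "t0 \<in> ball 0 e" "t0 \<noteq> 0" using e by (auto simp: t0_def)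
  then have "g t0 \<noteq> 0" using inj_onD[OF inj, of t0 0] g0 S e by auto
  then obtain k where k: "g t0 $ k \<noteq> 0" by (auto simp: vec_eq_iff)
  define h where "h t = g t $ k" for t
  have hol: "h holomorphic_on ball 0 e"
    using g holomorphic_on_subset e(2) unfolding h_def by blast
  have h0: "h 0 = 0" by (simp add: h_def g0)
  have "\<exists>n>0. (deriv ^^ n) h 0 \<noteq> 0"
  proof (rule ccontr)
    assume "\<not> ?thesis"
    then have der: "\<And>n. 0 < n \<Longrightarrow> (deriv ^^ n) h 0 = 0" by blast
    have "h t0 = h 0"
      using t0 e by (intro holomorphic_fun_eq_const_on_connected[OF hol _ _ der]) auto
    then show False using k h0 by (simp add: h_def)
  qed
  then obtain m where m: "m > 0" "(deriv ^^ m) h 0 \<noteq> 0"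
      "\<And>i. 0 < i \<Longrightarrow> i < m \<Longrightarrow> (deriv ^^ i) h 0 = 0"
    using exists_least_iff[of "\<lambda>n. n > 0 \<and> (deriv ^^ n) h 0 \<noteq> 0"] by blast
  obtain q r where q: "0 < r" "q holomorphic_on ball 0 r"
      "\<And>w. w \<in> ball 0 r \<Longrightarrow> h w - h 0 = ((w - 0) * q w) ^ m"
      "\<And>w. w \<in> ball 0 r \<Longrightarrow> q w \<noteq> 0"
  proof (rule holomorphic_factor_order_of_zero_strong[OF hol open_ball _ m(1,2)])
    show "0 \<in> ball 0 e" using e(1) by simp
    show "(deriv ^^ i) h 0 = 0" if "0 < i" "i < m" for i using m(3) that by blast
  qed (rule that)
  define \<phi> where "\<phi> w = w * q w" for w
  define r' where "r' = min r e"
  have r': "r' > 0" "ball (0 :: complex) r' \<subseteq> ball 0 r" "ball 0 r' \<subseteq> S"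
    using q(1) e by (auto simp: r'_def)
  have hol\<phi>: "\<phi> holomorphic_on ball 0 r'"
    unfolding \<phi>_def using holomorphic_on_subset[OF q(2) r'(2)] by (intro holomorphic_intros)
  have "(q has_field_derivative deriv q 0) (at 0)"
    using q(1,2) by (intro holomorphic_derivI[of _ "ball 0 r"]) auto
  then have "(\<phi> has_field_derivative q 0) (at 0)"
    unfolding \<phi>_def by (auto intro!: derivative_eq_intros)
  then have "deriv \<phi> 0 = q 0" by (rule DERIV_imp_deriv)
  then have d\<phi>: "deriv \<phi> 0 \<noteq> 0" using q(4)[of 0] q(1) by simp
  obtain \<rho> where \<rho>: "\<rho> > 0" "ball (0 :: complex) \<rho> \<subseteq> ball 0 r'" "inj_on \<phi> (ball 0 \<rho>)"
  proof (rule has_complex_derivative_locally_injective[OF hol\<phi> _ open_ball])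
    show "0 \<in> ball 0 r'" using r'(1) by simp
    show "deriv \<phi> 0 \<noteq> 0" by (rule d\<phi>)
  qed (rule that)
  define N where "N = ball (0 :: complex) \<rho>"
  have hol\<phi>N: "\<phi> holomorphic_on N" and N: "open N" "0 \<in> N" "inj_on \<phi> N"
    using holomorphic_on_subset[OF hol\<phi> \<rho>(2)] \<rho> by (auto simp: N_def)
  obtain u where u: "u holomorphic_on (\<phi> ` N)" "\<And>z. z \<in> N \<Longrightarrow> u (\<phi> z) = z"
  proof (rule holomorphic_has_inverse[OF hol\<phi>N N(1,3)])
  qed (rule that)
  have op: "open (\<phi> ` N)" by (rule open_mapping_thm3[OF hol\<phi>N N(1,3)])
  have \<phi>0: "\<phi> 0 = 0" by (simp add: \<phi>_def)
  then have "0 \<in> \<phi> ` N" "u 0 = 0" using N(2) u(2)[of 0] by force+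
  obtain R where R: "R > 0" "ball 0 R \<subseteq> \<phi> ` N"
    using openE[OF op \<open>0 \<in> \<phi> ` N\<close>] by blast
  have uN: "u s \<in> N" "\<phi> (u s) = s" if "s \<in> \<phi> ` N" for s using that u(2) by auto
  have NS: "N \<subseteq> S" using \<rho>(2) r'(3) by (auto simp: N_def)
  define G where "G s = g (u s)" for s
  have "(\<lambda>s. G s $ j) holomorphic_on \<phi> ` N" for j
  proof -
    have "(\<lambda>t. g t $ j) \<circ> u holomorphic_on \<phi> ` N"
      using holomorphic_on_subset[OF g NS] uN(1) by (intro holomorphic_on_compose_gen[OF u(1)]) auto
    then show ?thesis by (simp add: o_def G_def)
  qed
  then have Gan: "(\<lambda>s. G s $ j) analytic_on {0}" for j
    using op \<open>0 \<in> \<phi> ` N\<close> analytic_at by blast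
  have Ginj: "inj_on G (ball 0 R)"
  proof (rule inj_onI)
    fix x y assume xy: "x \<in> ball 0 R" "y \<in> ball 0 R" "G x = G y"
    then have "u x = u y" using inj_onD[OF inj] uN(1) NS R(2) unfolding G_def by blast
    then show "x = y" using xy R(2) uN(2) by (metis subsetD)
  qed
  have Gpow: "G s $ k = s ^ m" if "s \<in> ball 0 R" for s
  proof -
    have s: "s \<in> \<phi> ` N" using that R(2) by blast
    then have "u s \<in> ball 0 r" using uN(1) \<rho>(2) r'(2) unfolding N_def by blast
    then have "h (u s) = \<phi> (u s) ^ m" using q(3) h0 by (simp add: \<phi>_def)
    then show ?thesis using uN(2)[OF s] by (simp add: G_def h_def)
  qed
  obtain \<Delta> where \<Delta>: "\<Delta> analytic_on {0}" "\<not> (\<forall>\<^sub>F s in nhds 0. \<Delta> s = 0)"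
    "\<And>B. B analytic_on {0} \<Longrightarrow> \<exists>f\<in>holomorphic_germs. \<forall>\<^sub>F s in nhds 0. f (G s) = \<Delta> s * B s"
    using conductor_of_curve_with_power_coordinate[OF Gan R(1) Ginj Gpow m(1)] by blast
  have \<phi>an: "\<phi> analytic_on {0}" and uan: "u analytic_on {0}"
    using hol\<phi>N N u(1) op \<open>0 \<in> \<phi> ` N\<close> analytic_at by blast+
  have lim\<phi>: "filterlim \<phi> (nhds 0) (nhds 0)" and limu: "filterlim u (nhds 0) (nhds 0)"
    using analytic_at_imp_isCont[OF \<phi>an] analytic_at_imp_isCont[OF uan]
      tendsto_at_iff_tendsto_nhds[of \<phi> 0] tendsto_at_iff_tendsto_nhds[of u 0] \<phi>0 \<open>u 0 = 0\<close>
    by (simp_all add: isCont_def)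
  have evN: "\<forall>\<^sub>F t in nhds 0. t \<in> N" using N by (intro eventually_nhds_in_open)
  have ev\<phi>N: "\<forall>\<^sub>F t in nhds 0. t \<in> \<phi> ` N" using op \<open>0 \<in> \<phi> ` N\<close> by (intro eventually_nhds_in_open)
  have "(\<Delta> \<circ> \<phi>) analytic_on {0}"
    using \<phi>an \<Delta>(1) \<phi>0 by (intro analytic_on_compose) auto
  moreover have "\<not> (\<forall>\<^sub>F t in nhds 0. (\<Delta> \<circ> \<phi>) t = 0)"
  proof
    assume "\<forall>\<^sub>F t in nhds 0. (\<Delta> \<circ> \<phi>) t = 0"
    then have "\<forall>\<^sub>F s in nhds 0. (\<Delta> \<circ> \<phi>) (u s) = 0"
      using limu by (rule eventually_compose_filterlim)
    with ev\<phi>N have "\<forall>\<^sub>F s in nhds 0. \<Delta> s = 0"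
      by eventually_elim (auto simp: uN)
    with \<Delta>(2) show False by blast
  qed
  moreover have "\<exists>f\<in>holomorphic_germs. \<forall>\<^sub>F t in nhds 0. f (g t) = (\<Delta> \<circ> \<phi>) t * B t"
    if B: "B analytic_on {0}" for B
  proof -
    have "(B \<circ> u) analytic_on {0}"
      using uan B \<open>u 0 = 0\<close> by (intro analytic_on_compose) auto
    from \<Delta>(3)[OF this] obtain f where f: "f \<in> holomorphic_germs"
      "\<forall>\<^sub>F s in nhds 0. f (G s) = \<Delta> s * (B \<circ> u) s" by blast
    from f(2) lim\<phi> have "\<forall>\<^sub>F t in nhds 0. f (G (\<phi> t)) = \<Delta> (\<phi> t) * (B \<circ> u) (\<phi> t)"
      by (rule eventually_compose_filterlim)
    with evN have "\<forall>\<^sub>F t in nhds 0. f (g t) = (\<Delta> \<circ> \<phi>) t * B t"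
      by eventually_elim (simp add: G_def u(2))
    then show ?thesis using f(1) by blast
  qed
  ultimately show ?thesis by blast
qed

section \<open>The conductor of a reducible curve\<close>

lemma pullback_has_fps_expansion:
  assumes "normalization g X" "f \<in> holomorphic_germs"
  shows "(\<lambda>t. f (g t)) has_fps_expansion pullback g f"
proof -
  obtain D where D: "open D" "0 \<in> D" "\<And>k. (\<lambda>t. g t $ k) holomorphic_on D" "g 0 = 0"
    using assms(1) by (auto simp: normalization_def)
  obtain E where E: "open E" "0 \<in> E" "(f \<circ> g) holomorphic_on E"
    using holomorphic_germ_compose[OF assms(2) D(4) D(1,2,3)] by blast
  have "(f \<circ> g) has_fps_expansion pullback g f"
    unfolding pullback_def by (rule has_fps_expansion_fps_expansion[OF E])
  then show ?thesis by (simp add: o_def)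
qed

lemma pullback_eqI:
  assumes "normalization g X" "f \<in> holomorphic_germs" "(\<lambda>t. f (g t)) has_fps_expansion a"
  shows "pullback g f = a"
  using pullback_has_fps_expansion[OF assms(1,2)] assms(3) fps_expansion_unique_complex by blast

lemma pullback_add:
  assumes "normalization g X" "f \<in> holomorphic_germs" "h \<in> holomorphic_germs"
  shows "pullback g (\<lambda>z. f z + h z) = pullback g f + pullback g h"
  using assms
  by (intro pullback_eqI has_fps_expansion_add pullback_has_fps_expansion holomorphic_germs_add)

lemma pullback_mult:
  assumes "normalization g X" "f \<in> holomorphic_germs" "h \<in> holomorphic_germs"
  shows "pullback g (\<lambda>z. f z * h z) = pullback g f * pullback g h"
  using assms
  by (intro pullback_eqI has_fps_expansion_mult pullback_has_fps_expansion holomorphic_germs_mult)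

lemma pullback_const:
  assumes "normalization g X"
  shows "pullback g (\<lambda>z. c) = fps_const c"
  using assms by (intro pullback_eqI holomorphic_germs_const) auto

lemma pullback_sum:
  assumes "normalization g X" "\<And>a. a \<in> A \<Longrightarrow> f a \<in> holomorphic_germs"
  shows "pullback g (\<lambda>z. \<Sum>a\<in>A. f a z) = (\<Sum>a\<in>A. pullback g (f a))"
  using assms
  by (intro pullback_eqI has_fps_expansion_sum pullback_has_fps_expansion holomorphic_germs_sum)

lemma pullback_prod:
  assumes "normalization g X" "\<And>a. a \<in> A \<Longrightarrow> f a \<in> holomorphic_germs"
  shows "pullback g (\<lambda>z. \<Prod>a\<in>A. f a z) = (\<Prod>a\<in>A. pullback g (f a))"
  using assms
  by (intro pullback_eqI has_fps_expansion_prod pullback_has_fps_expansion holomorphic_germs_prod)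

lemma pullback_conv_radius:
  assumes "normalization g X" "f \<in> holomorphic_germs"
  shows "fps_conv_radius (pullback g f) > 0"
  using pullback_has_fps_expansion[OF assms] by (simp add: has_fps_expansion_def)

lemma le_fps_ord_iff: "enat n \<le> fps_ord a \<longleftrightarrow> (\<forall>k<n. fps_nth a k = 0)"
proof (cases "a = 0")
  case False
  have "n \<le> subdegree a \<longleftrightarrow> (\<forall>k<n. fps_nth a k = 0)"
    using False by (auto intro: subdegree_geI nth_less_subdegree_zero)
  then show ?thesis using False by (simp add: fps_ord_def)
qed (simp add: fps_ord_def)

text \<open>
  Dividing off the power of the variable leaves a unit among the convergent series.
\<close>

lemma fps_divisible_by_order:
  fixes a d :: "complex fps"
  assumes d: "d \<noteq> 0" "fps_conv_radius d > 0"
    and a: "fps_conv_radius a > 0" "enat (subdegree d) \<le> fps_ord a"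
  obtains b where "fps_conv_radius b > 0" "a = d * b"
proof -
  define n where "n = subdegree d"
  define e where "e = fps_shift n d"
  have d_eq: "d = e * fps_X ^ n" unfolding e_def n_def by (rule subdegree_decompose)
  have "fps_nth e 0 \<noteq> 0" using d(1) by (simp add: e_def n_def)
  then have inv: "e * inverse e = 1" "fps_conv_radius (inverse e) > 0"
    using d(2) fps_conv_radius_inverse_pos[of e]
    by (simp_all add: e_def inverse_mult_eq_1')
  have "a = fps_shift n a * fps_X ^ n"
    using a(2) by (intro fps_ext) (auto simp: le_fps_ord_iff n_def fps_X_power_mult_right_nth)
  also have "\<dots> = d * (fps_shift n a * inverse e)"
    using inv(1) by (simp add: d_eq mult_ac)
  finally have "a = d * (fps_shift n a * inverse e)" .
  moreover have "fps_conv_radius (fps_shift n a * inverse e) > 0"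
    using fps_conv_radius_mult[of "fps_shift n a" "inverse e"] a(1) inv(2)
    by (auto simp: min_def split: if_splits intro: less_le_trans)
  ultimately show ?thesis using that by blast
qed

lemma branch_conductor:
  assumes "normalization g X"
  obtains d where "d \<noteq> 0"
    "\<And>b. fps_conv_radius b > 0 \<Longrightarrow> \<exists>f\<in>holomorphic_germs. pullback g f = d * b"
proof -
  obtain D U where D: "open D" "0 \<in> D" "\<And>k. (\<lambda>t. g t $ k) holomorphic_on D" "g 0 = 0"
    and bij: "bij_betw g D (X \<inter> U)"
    using assms unfolding normalization_def by blast
  have inj: "inj_on g D" using bij by (simp add: bij_betw_def)
  obtain \<Delta> where \<Delta>: "\<Delta> analytic_on {0}" "\<not> (\<forall>\<^sub>F t in nhds 0. \<Delta> t = 0)"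
    "\<And>B. B analytic_on {0} \<Longrightarrow> \<exists>f\<in>holomorphic_germs. \<forall>\<^sub>F t in nhds 0. f (g t) = \<Delta> t * B t"
    using conductor_of_injective_curve[OF D(3,1,2,4) inj] by blast
  obtain d where d: "\<Delta> has_fps_expansion d"
    using analytic_at_imp_has_fps_expansion_0[OF \<Delta>(1)] by blast
  have "d \<noteq> 0" using \<Delta>(2) d by (auto simp: has_fps_expansion_0_iff)
  moreover have "\<exists>f\<in>holomorphic_germs. pullback g f = d * b" if b: "fps_conv_radius b > 0" for b
  proof -
    have eb: "eval_fps b has_fps_expansion b" by (rule eval_fps_has_fps_expansion[OF b])
    obtain f where f: "f \<in> holomorphic_germs" "\<forall>\<^sub>F t in nhds 0. f (g t) = \<Delta> t * eval_fps b t"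
      using \<Delta>(3)[OF has_fps_expansion_imp_analytic_0[OF eb]] by blast
    have "(\<lambda>t. f (g t)) has_fps_expansion d * b"
      using has_fps_expansion_mult[OF d eb] has_fps_expansion_cong[OF f(2) refl] by simp
    then show ?thesis using f(1) pullback_eqI[OF assms f(1)] by blast
  qed
  ultimately show ?thesis using that by blast
qed

text \<open>
  If all equations of \<open>Y\<close> vanished on \<open>Z\<close>, then \<open>Z\<close> would be contained in \<open>Y\<close>.
\<close>

lemma branch_equation_separating:
  assumes "irreducible_germ Y" "normalization g Y" "normalization h Z" "\<not> germ_le Z Y"
  obtains f where "f \<in> holomorphic_germs" "pullback g f = 0" "pullback h f \<noteq> 0"
proof -
  have "analytic_germ Y" using assms(1) by (simp add: irreducible_germ_def)
  then obtain U F where F: "open U" "0 \<in> U" "finite F" "\<forall>f\<in>F. holomorphic_cn f U"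
      "Y \<inter> U = {z \<in> U. \<forall>f\<in>F. f z = 0}"
    unfolding analytic_germ_def by blast
  have germ: "f \<in> holomorphic_germs" if "f \<in> F" for f
    using F that unfolding holomorphic_germs_def by blast
  have evU: "\<forall>\<^sub>F z in nhds 0. z \<in> U" using F(1,2) by (intro eventually_nhds_in_open)
  have "\<exists>f\<in>F. \<not> (\<forall>\<^sub>F z in nhds 0. z \<in> Z \<longrightarrow> f z = 0)"
  proof (rule ccontr)
    assume "\<not> ?thesis"
    then have "\<forall>\<^sub>F z in nhds 0. \<forall>f\<in>F. z \<in> Z \<longrightarrow> f z = 0"
      using F(3) by (intro eventually_ball_finite) auto
    with evU have "\<forall>\<^sub>F z in nhds 0. z \<in> Z \<longrightarrow> z \<in> Y"
      by eventually_elim (use F(5) in blast)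
    with assms(4) show False by (simp add: germ_le_def)
  qed
  then obtain f where f: "f \<in> F" "\<not> (\<forall>\<^sub>F z in nhds 0. z \<in> Z \<longrightarrow> f z = 0)" by blast
  have "\<forall>\<^sub>F z in nhds 0. z \<in> Y \<longrightarrow> f z = 0"
    using evU by eventually_elim (use F(5) f(1) in blast)
  then have "pullback g f = 0"
    using pullback_eq_0_iff[OF germ[OF f(1)] assms(2)]
      normalization_eventually_iff[OF assms(2), of "\<lambda>z. f z = 0"] by simp
  moreover have "pullback h f \<noteq> 0"
    using f(2) pullback_eq_0_iff[OF germ[OF f(1)] assms(3)]
      normalization_eventually_iff[OF assms(3), of "\<lambda>z. f z = 0"] by simp
  ultimately show ?thesis using that germ f(1) by blast
qed

text \<open>
  Multiplication by a function \<open>q\<close> that vanishes on all other branches but not on \<open>C i\<close> turns a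
  conductor of the branch into one whose functions are zero on the other branches.
\<close>

lemma branch_conductor_in_curve:
  assumes dec: "irreducible_decomposition I C X"
    and nrm: "\<And>i. i \<in> I \<Longrightarrow> normalization (\<gamma> i) (C i)"
    and i: "i \<in> I"
  obtains c where "\<And>a. fps_conv_radius a > 0 \<Longrightarrow> enat c \<le> fps_ord a \<Longrightarrow>
    \<exists>f\<in>holomorphic_germs. pullback (\<gamma> i) f = a \<and> (\<forall>j\<in>I - {i}. pullback (\<gamma> j) f = 0)"
proof -
  have fin: "finite I" using dec by (simp add: irreducible_decomposition_def)
  have "\<exists>f\<in>holomorphic_germs. pullback (\<gamma> j) f = 0 \<and> pullback (\<gamma> i) f \<noteq> 0" if j: "j \<in> I - {i}" for j
  proof -
    have "irreducible_germ (C j)" "\<not> germ_le (C i) (C j)"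
      using dec i j by (auto simp: irreducible_decomposition_def)
    then show ?thesis
      using branch_equation_separating[of "C j" "\<gamma> j" "\<gamma> i" "C i"] nrm i j by blast
  qed
  then obtain e where e: "\<And>j. j \<in> I - {i} \<Longrightarrow> e j \<in> holomorphic_germs"
      "\<And>j. j \<in> I - {i} \<Longrightarrow> pullback (\<gamma> j) (e j) = 0"
      "\<And>j. j \<in> I - {i} \<Longrightarrow> pullback (\<gamma> i) (e j) \<noteq> 0"
    by metis
  define q where "q z = (\<Prod>j\<in>I - {i}. e j z)" for z
  have q: "q \<in> holomorphic_germs" unfolding q_def by (intro holomorphic_germs_prod e(1))
  have pq: "pullback (\<gamma> k) q = (\<Prod>j\<in>I - {i}. pullback (\<gamma> k) (e j))" if "k \<in> I" for k
    unfolding q_def by (rule pullback_prod[OF nrm[OF that] e(1)])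
  have qi: "pullback (\<gamma> i) q \<noteq> 0" using pq[OF i] e(3) fin by simp
  have qj: "pullback (\<gamma> j) q = 0" if "j \<in> I - {i}" for j
    using pq[of j] that e(2) fin by (auto intro!: prod_zero)
  obtain d where d: "d \<noteq> 0"
      "\<And>b. fps_conv_radius b > 0 \<Longrightarrow> \<exists>f\<in>holomorphic_germs. pullback (\<gamma> i) f = d * b"
    using branch_conductor[OF nrm[OF i]] by blast
  define D where "D = d * pullback (\<gamma> i) q"
  have lift: "\<exists>f\<in>holomorphic_germs. pullback (\<gamma> i) f = D * b \<and> (\<forall>j\<in>I - {i}. pullback (\<gamma> j) f = 0)"
    if b: "fps_conv_radius b > 0" for b
  proof -
    obtain f where f: "f \<in> holomorphic_germs" "pullback (\<gamma> i) f = d * b" using d(2)[OF b] by blast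
    have "(\<lambda>z. f z * q z) \<in> holomorphic_germs" by (intro holomorphic_germs_mult f q)
    moreover have "pullback (\<gamma> i) (\<lambda>z. f z * q z) = D * b"
      using pullback_mult[OF nrm[OF i] f(1) q] f(2) by (simp add: D_def mult_ac)
    moreover have "pullback (\<gamma> j) (\<lambda>z. f z * q z) = 0" if "j \<in> I - {i}" for j
      using pullback_mult[OF nrm f(1) q] qj that by simp
    ultimately show ?thesis by blast
  qed
  have "D \<noteq> 0" using d(1) qi by (simp add: D_def)
  moreover have "fps_conv_radius D > 0"
    using lift[of 1] pullback_conv_radius[OF nrm[OF i]] by (auto simp: zero_ereal_def)
  ultimately show ?thesis
    using that[of "subdegree D"] lift fps_divisible_by_order by metis
qed

section \<open>The filtration by orders\<close>

interpretation fun_space: vector_space scale_fun by (rule vector_space_scale_fun)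
interpretation fps_space: vector_space scale_fps by (rule vector_space_scale_fps)
interpretation fun_fps: vector_space_pair scale_fun scale_fps by unfold_locales

definition order_filtration :: "'i set \<Rightarrow> ('i \<Rightarrow> int) \<Rightarrow> ('i \<Rightarrow> complex fps) set" where
  "order_filtration J l = {a. \<forall>i\<in>J. enat (nat (l i)) \<le> fps_ord (a i)}"

lemma subspace_holomorphic_germs: "fun_space.subspace holomorphic_germs"
  unfolding fun_space.subspace_def scale_fun_def zero_fun_def plus_fun_def
  by (auto intro: holomorphic_germs_const holomorphic_germs_add holomorphic_germs_mult)

lemma subspace_order_filtration: "fps_space.subspace (order_filtration J l)"
  unfolding fps_space.subspace_def
  by (auto simp: order_filtration_def le_fps_ord_iff scale_fps_def)

lemma subspace_normalization_ring:
  fixes J :: "'i set"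
  shows "fps_space.subspace (normalization_ring J)"
  unfolding fps_space.subspace_def
proof (intro conjI ballI allI)
  fix a b :: "'i \<Rightarrow> complex fps"
  assume "a \<in> normalization_ring J" "b \<in> normalization_ring J"
  moreover have "0 < fps_conv_radius (a i + b i)"
    if "0 < fps_conv_radius (a i)" "0 < fps_conv_radius (b i)" for i
    by (rule less_le_trans[OF _ fps_conv_radius_add]) (use that in simp)
  ultimately show "a + b \<in> normalization_ring J" by (simp add: normalization_ring_def)
next
  fix c and a :: "'i \<Rightarrow> complex fps" assume "a \<in> normalization_ring J"
  moreover have "0 < fps_conv_radius (fps_const c * a i)" if "0 < fps_conv_radius (a i)" for i
    by (rule less_le_trans[OF _ fps_conv_radius_mult]) (use that in simp)
  ultimately show "scale_fps c a \<in> normalization_ring J"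
    by (simp add: normalization_ring_def scale_fps_def)
qed (auto simp: normalization_ring_def)

text \<open>
  Raising one exponent by one imposes one linear condition, the vanishing of the coefficient at
  \<open>l i\<close>, so the codimension grows by one or stays the same.
\<close>

lemma quotient_dim_order_filtration_step:
  assumes S: "fps_space.subspace S" and i: "i \<in> J" "0 \<le> l i"
  shows "quotient_dim scale_fps S (order_filtration J (l(i := l i + 1))) =
    quotient_dim scale_fps S (order_filtration J l) +
    of_bool (\<exists>a\<in>S \<inter> order_filtration J l. fps_nth (a i) (nat (l i)) \<noteq> 0)"
proof -
  have nat: "nat (l i + 1) = Suc (nat (l i))" using i(2) by simp
  have mem: "a \<in> order_filtration J (l(i := l i + 1)) \<longleftrightarrow>
      a \<in> order_filtration J l \<and> fps_nth (a i) (nat (l i)) = 0" for a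
    using i by (auto simp: order_filtration_def le_fps_ord_iff nat less_Suc_eq)
  show ?thesis
  proof (subst fps_space.quotient_dim_add[OF S subspace_order_filtration subspace_order_filtration])
    show "order_filtration J (l(i := l i + 1)) \<subseteq> order_filtration J l" using mem by blast
    have "quotient_dim scale_fps (S \<inter> order_filtration J l) (order_filtration J (l(i := l i + 1))) =
        of_bool (\<exists>a\<in>S \<inter> order_filtration J l. fps_nth (a i) (nat (l i)) \<noteq> 0)"
      by (rule fps_space.quotient_dim_functional_kernel)
        (use mem in \<open>auto simp: scale_fps_def intro!: fps_space.subspace_inter S subspace_order_filtration\<close>)
    then show "quotient_dim scale_fps S (order_filtration J l) +
      quotient_dim scale_fps (S \<inter> order_filtration J l) (order_filtration J (l(i := l i + 1))) =
      quotient_dim scale_fps S (order_filtration J l) +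
      of_bool (\<exists>a\<in>S \<inter> order_filtration J l. fps_nth (a i) (nat (l i)) \<noteq> 0)" by simp
  qed
qed

text \<open>
  Every exponent is reached by unit steps in the directions of \<open>J\<close> from one whose components in \<open>J\<close>
  are nonpositive; for the latter the filtration is the whole space.
\<close>

lemma quotient_dim_order_filtration_induct:
  fixes P :: "('i \<Rightarrow> int) \<Rightarrow> bool"
  assumes "finite J"
    and base: "\<And>l. (\<And>i. i \<in> J \<Longrightarrow> l i \<le> 0) \<Longrightarrow> P l"
    and step: "\<And>l i. i \<in> J \<Longrightarrow> 0 \<le> l i \<Longrightarrow> P l \<Longrightarrow> P (l(i := l i + 1))"
  shows "P l"
proof (induction "\<Sum>i\<in>J. nat (l i)" arbitrary: l)
  case 0
  then show ?case using assms(1) by (intro base) auto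
next
  case (Suc n)
  have "\<exists>i\<in>J. l i > 0"
  proof (rule ccontr)
    assume "\<not> ?thesis"
    then have "(\<Sum>i\<in>J. nat (l i)) = 0" by (intro sum.neutral) auto
    with Suc(2) show False by simp
  qed
  then obtain i where i: "i \<in> J" "l i > 0" by blast
  define m where "m = l(i := l i - 1)"
  have l: "l = m(i := m i + 1)" by (simp add: m_def)
  have "(\<Sum>i\<in>J. nat (l i)) = nat (l i) + (\<Sum>j\<in>J - {i}. nat (l j))"
    using assms(1) i by (simp add: sum.remove)
  moreover have "(\<Sum>i\<in>J. nat (m i)) = nat (m i) + (\<Sum>j\<in>J - {i}. nat (l j))"
    using assms(1) i by (simp add: sum.remove m_def)
  moreover have "nat (l i) = Suc (nat (m i))" using i by (simp add: m_def)
  ultimately have "n = (\<Sum>i\<in>J. nat (m i))" using Suc(2) by simp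
  then have "P m" by (rule Suc(1))
  then show ?case unfolding l using i by (intro step) (auto simp: m_def)
qed

lemma quotient_dim_order_filtration_finite:
  assumes "finite J" "fps_space.subspace S"
  shows "quotient_dim scale_fps S (order_filtration J l) \<noteq> \<infinity>"
proof (induction l rule: quotient_dim_order_filtration_induct[OF assms(1)])
  case (1 l)
  then have "S \<subseteq> order_filtration J l" by (auto simp: order_filtration_def simp flip: zero_enat_def)
  then show ?case by (simp add: fps_space.quotient_dim_eq_0)
next
  case (2 l i)
  then show ?case by (subst quotient_dim_order_filtration_step[OF assms(2)]) (auto simp: one_enat_def)
qed

lemma quotient_dim_normalization_ring:
  assumes "finite J"
  shows "quotient_dim scale_fps (normalization_ring J) (order_filtration J l) = enat (\<Sum>i\<in>J. nat (l i))"
proof (induction l rule: quotient_dim_order_filtration_induct[OF assms(1)])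
  case (1 l)
  then have "normalization_ring J \<subseteq> order_filtration J l" "(\<Sum>i\<in>J. nat (l i)) = 0"
    by (auto simp: order_filtration_def simp flip: zero_enat_def)
  then show ?case by (simp add: fps_space.quotient_dim_eq_0 zero_enat_def)
next
  case (2 l i)
  define a :: "'a \<Rightarrow> complex fps" where "a j = (if j \<in> J then fps_X ^ nat (l j) else 0)" for j
  have "a \<in> normalization_ring J \<inter> order_filtration J l"
    by (auto simp: a_def normalization_ring_def order_filtration_def le_fps_ord_iff)
  moreover have "fps_nth (a i) (nat (l i)) \<noteq> 0" using 2 by (simp add: a_def)
  ultimately have "\<exists>a\<in>normalization_ring J \<inter> order_filtration J l. fps_nth (a i) (nat (l i)) \<noteq> 0"
    by blast
  moreover have "(\<Sum>j\<in>J. nat ((l(i := l i + 1)) j)) = Suc (\<Sum>j\<in>J. nat (l j))"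
    using 2 assms by (simp add: sum.remove[of J i] Suc_nat_eq_nat_zadd1 add.commute)
  ultimately show ?case
    using 2 by (subst quotient_dim_order_filtration_step[OF subspace_normalization_ring])
      (auto simp: one_enat_def)
qed

section \<open>The Hilbert function and the conductor\<close>

lemma multi_pullback_add:
  assumes "\<forall>j\<in>J. normalization (\<gamma> j) (C j)" "f \<in> holomorphic_germs" "h \<in> holomorphic_germs"
  shows "multi_pullback \<gamma> J (f + h) = multi_pullback \<gamma> J f + multi_pullback \<gamma> J h"
  using assms pullback_add[of "\<gamma> _" "C _" f h]
  by (auto simp: multi_pullback_def plus_fun_def fun_eq_iff)

lemma multi_pullback_scale:
  assumes "\<forall>j\<in>J. normalization (\<gamma> j) (C j)" "f \<in> holomorphic_germs"
  shows "multi_pullback \<gamma> J (scale_fun c f) = scale_fps c (multi_pullback \<gamma> J f)"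
  using assms pullback_mult[of "\<gamma> _" "C _" "\<lambda>_. c" f] pullback_const[of "\<gamma> _" "C _" c]
  by (auto simp: multi_pullback_def scale_fun_def scale_fps_def fun_eq_iff holomorphic_germs_const)

lemma subspace_multi_pullback:
  assumes "\<forall>j\<in>J. normalization (\<gamma> j) (C j)"
  shows "fps_space.subspace (multi_pullback \<gamma> J ` holomorphic_germs)"
  unfolding fps_space.subspace_def
proof (intro conjI ballI allI)
  have "multi_pullback \<gamma> J (\<lambda>_. 0) = 0"
    using assms pullback_const[of "\<gamma> _" "C _" 0] by (auto simp: multi_pullback_def fun_eq_iff)
  then show "0 \<in> multi_pullback \<gamma> J ` holomorphic_germs"
    using holomorphic_germs_const by (metis image_eqI)
next
  fix a b
  assume a: "a \<in> multi_pullback \<gamma> J ` holomorphic_germs"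
    and b: "b \<in> multi_pullback \<gamma> J ` holomorphic_germs"
  obtain f where f: "a = multi_pullback \<gamma> J f" "f \<in> holomorphic_germs" using a by (rule imageE)
  obtain h where h: "b = multi_pullback \<gamma> J h" "h \<in> holomorphic_germs" using b by (rule imageE)
  have "a + b = multi_pullback \<gamma> J (f + h)"
    unfolding f(1) h(1) by (rule multi_pullback_add[OF assms f(2) h(2), symmetric])
  then show "a + b \<in> multi_pullback \<gamma> J ` holomorphic_germs"
    using fun_space.subspace_add[OF subspace_holomorphic_germs f(2) h(2)] by (simp only: imageI)
next
  fix c a
  assume a: "a \<in> multi_pullback \<gamma> J ` holomorphic_germs"
  obtain f where f: "a = multi_pullback \<gamma> J f" "f \<in> holomorphic_germs" using a by (rule imageE)
  have "scale_fps c a = multi_pullback \<gamma> J (scale_fun c f)"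
    unfolding f(1) by (rule multi_pullback_scale[OF assms f(2), symmetric])
  then show "scale_fps c a \<in> multi_pullback \<gamma> J ` holomorphic_germs"
    using fun_space.subspace_scale[OF subspace_holomorphic_germs f(2)] by (simp only: imageI)
qed

lemma multi_pullback_subset_normalization_ring:
  assumes "\<forall>j\<in>J. normalization (\<gamma> j) (C j)"
  shows "multi_pullback \<gamma> J ` holomorphic_germs \<subseteq> normalization_ring J"
  by (auto simp: multi_pullback_def normalization_ring_def intro: pullback_conv_radius[OF bspec[OF assms]])

text \<open>
  The local ring and the filtration can thus be studied inside the product of the power series
  rings.
\<close>

lemma hilbert_function_eq_quotient_dim:
  assumes "\<forall>j\<in>J. normalization (\<gamma> j) (C j)"
  shows "hilbert_function \<gamma> J l =
    quotient_dim scale_fps (multi_pullback \<gamma> J ` holomorphic_germs) (order_filtration J l)"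
proof -
  have "val_ideal \<gamma> J l = {f \<in> holomorphic_germs. multi_pullback \<gamma> J f \<in> order_filtration J l}"
    by (auto simp: val_ideal_def order_filtration_def val_def multi_pullback_def)
  moreover have "0 \<in> order_filtration J l"
    by (rule fps_space.subspace_0[OF subspace_order_filtration])
  ultimately show ?thesis
    unfolding hilbert_function_def
    by (simp add: fun_fps.quotient_dim_image[where f = "multi_pullback \<gamma> J"]
        subspace_holomorphic_germs multi_pullback_add[OF assms] multi_pullback_scale[OF assms])
qed

lemma hilbert_function_finite:
  assumes "finite J" "\<forall>j\<in>J. normalization (\<gamma> j) (C j)"
  shows "hilbert_function \<gamma> J l \<noteq> \<infinity>"
  unfolding hilbert_function_eq_quotient_dim[OF assms(2)]
  by (rule quotient_dim_order_filtration_finite[OF assms(1) subspace_multi_pullback[OF assms(2)]])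

lemma hilbert_function_restrict:
  assumes "K \<subseteq> J"
  shows "hilbert_function \<gamma> J (\<lambda>i. if i \<in> K then l i else 0) = hilbert_function \<gamma> K l"
proof -
  have "val_ideal \<gamma> J (\<lambda>i. if i \<in> K then l i else 0) = val_ideal \<gamma> K l"
    using assms by (auto simp: val_ideal_def simp flip: zero_enat_def)
  then show ?thesis by (simp add: hilbert_function_def)
qed

text \<open>
  The sum of the conductor exponents of the branches serves all of them, and an element of the
  product is the sum of its components. As the functions found for the branches vanish on all other
  branches of the whole curve, one exponent works for all subcurves.
\<close>

lemma curve_conductor:
  assumes dec: "irreducible_decomposition I C X"
    and nrm: "\<And>i. i \<in> I \<Longrightarrow> normalization (\<gamma> i) (C i)"
  obtains c where "\<And>J. J \<subseteq> I \<Longrightarrow>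
    normalization_ring J \<inter> order_filtration J (\<lambda>_. int c) \<subseteq> multi_pullback \<gamma> J ` holomorphic_germs"
proof -
  have fin: "finite I" using dec by (simp add: irreducible_decomposition_def)
  have "\<exists>c. \<forall>a. fps_conv_radius a > 0 \<and> enat c \<le> fps_ord a \<longrightarrow>
      (\<exists>f\<in>holomorphic_germs. pullback (\<gamma> i) f = a \<and> (\<forall>j\<in>I - {i}. pullback (\<gamma> j) f = 0))" if "i \<in> I" for i
  proof (rule branch_conductor_in_curve[OF dec nrm that])
  qed blast+
  then obtain c where c: "\<And>i a. i \<in> I \<Longrightarrow> fps_conv_radius a > 0 \<Longrightarrow> enat (c i) \<le> fps_ord a \<Longrightarrow>
      \<exists>f\<in>holomorphic_germs. pullback (\<gamma> i) f = a \<and> (\<forall>j\<in>I - {i}. pullback (\<gamma> j) f = 0)"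
    by metis
  have "normalization_ring J \<inter> order_filtration J (\<lambda>_. int (\<Sum>i\<in>I. c i)) \<subseteq> multi_pullback \<gamma> J ` holomorphic_germs"
    if J: "J \<subseteq> I" for J
  proof
    fix a assume a: "a \<in> normalization_ring J \<inter> order_filtration J (\<lambda>_. int (\<Sum>i\<in>I. c i))"
    have "\<exists>f\<in>holomorphic_germs. pullback (\<gamma> i) f = a i \<and> (\<forall>j\<in>I - {i}. pullback (\<gamma> j) f = 0)"
      if i: "i \<in> J" for i
    proof (rule c)
      show "i \<in> I" using i J by blast
      show "fps_conv_radius (a i) > 0" using a i by (auto simp: normalization_ring_def)
      have "c i \<le> (\<Sum>i\<in>I. c i)" using \<open>i \<in> I\<close> fin by (intro member_le_sum) auto
      then have "enat (c i) \<le> enat (\<Sum>i\<in>I. c i)" by simp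
      also have "\<dots> \<le> fps_ord (a i)" using a i unfolding order_filtration_def by (auto simp del: of_nat_sum)
      finally show "enat (c i) \<le> fps_ord (a i)" .
    qed
    then obtain f where f: "\<And>i. i \<in> J \<Longrightarrow> f i \<in> holomorphic_germs"
        "\<And>i. i \<in> J \<Longrightarrow> pullback (\<gamma> i) (f i) = a i"
        "\<And>i j. i \<in> J \<Longrightarrow> j \<in> I - {i} \<Longrightarrow> pullback (\<gamma> j) (f i) = 0"
      by metis
    define h where "h z = (\<Sum>i\<in>J. f i z)" for z
    have "h \<in> holomorphic_germs" unfolding h_def by (intro holomorphic_germs_sum f(1))
    moreover have "pullback (\<gamma> j) h = a j" if j: "j \<in> J" for j
    proof -
      have "pullback (\<gamma> j) h = (\<Sum>i\<in>J. pullback (\<gamma> j) (f i))"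
        unfolding h_def using j J by (intro pullback_sum[OF nrm] f(1)) auto
      also have "\<dots> = (\<Sum>i\<in>J. if i = j then a j else 0)"
        using f(2,3) j J by (intro sum.cong) auto
      also have "\<dots> = a j" using j J fin finite_subset by (subst sum.delta) auto
      finally show ?thesis .
    qed
    then have "multi_pullback \<gamma> J h = a"
      using a by (auto simp: multi_pullback_def normalization_ring_def fun_eq_iff)
    ultimately show "a \<in> multi_pullback \<gamma> J ` holomorphic_germs" by blast
  qed
  then show ?thesis using that by blast
qed

text \<open>
  The codimension of \<open>N \<inter> W\<close> in \<open>N\<close>, for the normalization ring \<open>N\<close> and the elements \<open>W\<close> of order at
  least \<open>n\<close>, is \<open>n * card J\<close>. The chain \<open>N \<inter> W \<subseteq> R \<subseteq> N\<close>, whose first inclusion is the conductor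
  property, splits it into the delta invariant and a value of the Hilbert function. In particular
  both are finite.
\<close>

lemma hilbert_function_plus_delta:
  assumes "finite J" "\<forall>j\<in>J. normalization (\<gamma> j) (C j)"
    and cond: "normalization_ring J \<inter> order_filtration J (\<lambda>_. int c) \<subseteq> multi_pullback \<gamma> J ` holomorphic_germs"
    and n: "n \<ge> c"
  shows "delta \<gamma> J + hilbert_function \<gamma> J (\<lambda>_. int n) = enat (n * card J)"
proof -
  define R where "R = multi_pullback \<gamma> J ` holomorphic_germs"
  define N where "N = (normalization_ring J :: ('a \<Rightarrow> complex fps) set)"
  define W where "W = order_filtration J (\<lambda>_. int n)"
  have sub: "fps_space.subspace R" "fps_space.subspace N" "fps_space.subspace W"
    unfolding R_def N_def W_def
    using subspace_multi_pullback[OF assms(2)] subspace_normalization_ring subspace_order_filtration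
    by blast+
  have RN: "R \<subseteq> N" unfolding R_def N_def by (rule multi_pullback_subset_normalization_ring[OF assms(2)])
  have "W \<subseteq> order_filtration J (\<lambda>_. int c)"
    unfolding W_def order_filtration_def using n
    by (auto intro: order_trans[of "enat c" "enat n"])
  then have NWR: "N \<inter> W \<subseteq> R" using cond unfolding N_def R_def by blast
  have "enat (n * card J) = quotient_dim scale_fps N W"
    unfolding N_def W_def using quotient_dim_normalization_ring[OF assms(1), of "\<lambda>_. int n"]
    by (simp add: mult.commute)
  also have "\<dots> = quotient_dim scale_fps N (N \<inter> W)"
    by (rule fps_space.quotient_dim_cong[OF sub(2)]) auto
  also have "\<dots> = quotient_dim scale_fps N R + quotient_dim scale_fps (N \<inter> R) (N \<inter> W)"
    by (rule fps_space.quotient_dim_add[OF sub(2,1) fps_space.subspace_inter[OF sub(2,3)] NWR])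
  also have "N \<inter> R = R" using RN by blast
  also have "quotient_dim scale_fps R (N \<inter> W) = quotient_dim scale_fps R W"
    using RN by (intro fps_space.quotient_dim_cong[OF sub(1)]) auto
  also have "\<dots> = hilbert_function \<gamma> J (\<lambda>_. int n)"
    unfolding R_def W_def by (rule hilbert_function_eq_quotient_dim[OF assms(2), symmetric])
  also have "quotient_dim scale_fps N R = delta \<gamma> J"
    by (simp add: delta_def N_def R_def)
  finally show ?thesis by simp
qed

text \<open>
  The pure power \<open>t ^ l i\<close> on the branch \<open>i\<close>, extended by zero to the other branches, belongs to the
  local ring by the conductor property and separates the two steps of the filtration.
\<close>

lemma hilbert_function_step_above_conductor:
  assumes "\<forall>j\<in>J. normalization (\<gamma> j) (C j)"
    and cond: "normalization_ring J \<inter> order_filtration J (\<lambda>_. int c) \<subseteq> multi_pullback \<gamma> J ` holomorphic_germs"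
    and i: "i \<in> J" "int c \<le> l i"
  shows "hilbert_function \<gamma> J (l(i := l i + 1)) = hilbert_function \<gamma> J l + 1"
proof -
  define a :: "'a \<Rightarrow> complex fps" where "a j = (if j = i then fps_X ^ nat (l i) else 0)" for j
  have "a \<in> normalization_ring J" using i(1) by (auto simp: a_def normalization_ring_def)
  moreover have "a \<in> order_filtration J (\<lambda>_. int c)" "a \<in> order_filtration J l"
    using i(2) by (auto simp: a_def order_filtration_def le_fps_ord_iff)
  moreover have "fps_nth (a i) (nat (l i)) \<noteq> 0" by (simp add: a_def)
  ultimately have "\<exists>a\<in>multi_pullback \<gamma> J ` holomorphic_germs \<inter> order_filtration J l. fps_nth (a i) (nat (l i)) \<noteq> 0"
    using cond by blast
  then show ?thesis
    unfolding hilbert_function_eq_quotient_dim[OF assms(1)]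
    using i by (subst quotient_dim_order_filtration_step[OF subspace_multi_pullback[OF assms(1)]]) auto
qed

lemma hilbert_function_0: "hilbert_function \<gamma> J (\<lambda>_. 0) = 0"
proof -
  have "holomorphic_germs \<subseteq> val_ideal \<gamma> J (\<lambda>_. 0)"
    by (auto simp: val_ideal_def simp flip: zero_enat_def)
  then show ?thesis by (simp add: hilbert_function_def fun_space.quotient_dim_eq_0)
qed


section \<open>Mixed differences\<close>

lemma sum_Pow_insert:
  assumes "finite A" "i \<notin> A"
  shows "(\<Sum>K\<in>Pow (insert i A). f K) = (\<Sum>K\<in>Pow A. f K + f (insert i K))"
proof -
  have "(\<Sum>K\<in>Pow (insert i A). f K) = (\<Sum>K\<in>Pow A. f K) + (\<Sum>K\<in>insert i ` Pow A. f K)"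
    unfolding Pow_insert using assms by (intro sum.union_disjoint) auto
  also have "(\<Sum>K\<in>insert i ` Pow A. f K) = (\<Sum>K\<in>Pow A. f (insert i K))"
    using assms by (subst sum.reindex) (auto simp: inj_on_def)
  finally show ?thesis by (simp add: sum.distrib)
qed

lemma alternating_sum_Pow_insert:
  fixes F :: "'i set \<Rightarrow> int"
  assumes "finite A" "i \<notin> A"
  shows "(\<Sum>K\<in>Pow (insert i A). (-1) ^ card K * F K) = (\<Sum>K\<in>Pow A. (-1) ^ card K * (F K - F (insert i K)))"
  unfolding sum_Pow_insert[OF assms]
proof (intro sum.cong refl)
  fix K assume K: "K \<in> Pow A"
  then have "finite K" "i \<notin> K" using assms finite_subset by auto
  then show "(-1) ^ card K * F K + (-1) ^ card (insert i K) * F (insert i K) =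
      (-1) ^ card K * (F K - F (insert i K))" by (simp add: algebra_simps)
qed

definition exponent_box :: "'i set \<Rightarrow> int \<Rightarrow> ('i \<Rightarrow> int) set" where
  "exponent_box J N = {l. (\<forall>i. i \<notin> J \<longrightarrow> l i = 0) \<and> (\<forall>i\<in>J. 0 \<le> l i \<and> l i < N)}"

lemma exponent_box_insert:
  assumes "i \<notin> J"
  shows "exponent_box (insert i J) N = (\<lambda>(k, l). l(i := k)) ` ({0..<N} \<times> exponent_box J N)"
proof (intro equalityI subsetI)
  fix l assume l: "l \<in> exponent_box (insert i J) N"
  have "l = (\<lambda>(k, l). l(i := k)) (l i, l(i := 0))" by simp
  moreover have "(l i, l(i := 0)) \<in> {0..<N} \<times> exponent_box J N"
    using l assms by (auto simp: exponent_box_def)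
  ultimately show "l \<in> (\<lambda>(k, l). l(i := k)) ` ({0..<N} \<times> exponent_box J N)"
    by (rule image_eqI)
qed (auto simp: exponent_box_def)

lemma inj_on_exponent_box_insert:
  assumes "i \<notin> J"
  shows "inj_on (\<lambda>(k, l). l(i := k)) ({0..<N} \<times> exponent_box J N)"
proof (rule inj_onI, clarify)
  fix k l k' l'
  assume l: "l \<in> exponent_box J N" "l' \<in> exponent_box J N" and eq: "l(i := k) = l'(i := k')"
  have "k = k'" using fun_cong[OF eq, of i] by simp
  moreover have "l j = l' j" for j
    using fun_cong[OF eq, of j] l assms by (cases "j = i") (auto simp: exponent_box_def)
  ultimately show "k = k' \<and> l = l'" by auto
qed

lemma finite_exponent_box:
  assumes "finite J"
  shows "finite (exponent_box J N)"
  using assms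
proof (induction J rule: finite_induct)
  case empty
  have "exponent_box {} N \<subseteq> {\<lambda>_. 0}" by (auto simp: exponent_box_def)
  then show ?case using finite_subset by blast
qed (simp add: exponent_box_insert)

lemma sum_atLeastLessThan_telescope_int:
  fixes f :: "int \<Rightarrow> int"
  assumes "0 \<le> N"
  shows "(\<Sum>k\<in>{0..<N}. f k - f (k + 1)) = f 0 - f N"
proof -
  have "(\<Sum>k\<in>{0..<int n}. f k - f (k + 1)) = f 0 - f (int n)" for n
  proof (induction n)
    case (Suc n)
    have "{0..<int (Suc n)} = insert (int n) {0..<int n}" by auto
    then show ?case using Suc by (simp add: add.commute)
  qed simp
  from this[of "nat N"] show ?thesis using assms by simp
qed

text \<open>
  The one-dimensional telescoping sum, applied in each coordinate direction in turn. The upper corner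
  of the box in the directions \<open>K\<close> contributes with the sign of \<open>K\<close>.
\<close>

lemma sum_exponent_box_mixed_difference:
  fixes F :: "('i \<Rightarrow> int) \<Rightarrow> int"
  assumes "finite J" "0 \<le> N"
  shows "(\<Sum>l\<in>exponent_box J N. \<Sum>K\<in>Pow J. (-1) ^ card K * F (\<lambda>i. l i + of_bool (i \<in> K))) =
    (\<Sum>K\<in>Pow J. (-1) ^ card K * F (\<lambda>i. if i \<in> K then N else 0))"
  using assms(1)
proof (induction J arbitrary: F rule: finite_induct)
  case empty
  have "exponent_box {} N = {\<lambda>_ :: 'i. 0}" by (auto simp: exponent_box_def)
  then show ?case by simp
next
  case (insert i J)
  define F' where "F' l = F (l(i := 0)) - F (l(i := N))" for l
  have telescope: "(\<Sum>k\<in>{0..<N}. F (m(i := k)) - F (m(i := k + 1))) = F' m" for m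
    using sum_atLeastLessThan_telescope_int[OF assms(2), of "\<lambda>k. F (m(i := k))"]
    by (simp only: F'_def)
  have shift: "(\<lambda>j. (l(i := k)) j + of_bool (j \<in> K)) = (\<lambda>j. l j + of_bool (j \<in> K))(i := k)"
    "(\<lambda>j. (l(i := k)) j + of_bool (j \<in> insert i K)) = (\<lambda>j. l j + of_bool (j \<in> K))(i := k + 1)"
    if "K \<in> Pow J" for l :: "'i \<Rightarrow> int" and k K
    using that insert.hyps(2) by (auto simp: fun_eq_iff)
  have "(\<Sum>l\<in>exponent_box (insert i J) N. \<Sum>K\<in>Pow (insert i J). (-1) ^ card K * F (\<lambda>j. l j + of_bool (j \<in> K))) =
    (\<Sum>(k, l)\<in>{0..<N} \<times> exponent_box J N. \<Sum>K\<in>Pow (insert i J). (-1) ^ card K * F (\<lambda>j. (l(i := k)) j + of_bool (j \<in> K)))"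
    unfolding exponent_box_insert[OF insert.hyps(2)]
    by (subst sum.reindex[OF inj_on_exponent_box_insert[OF insert.hyps(2)]])
      (simp add: case_prod_unfold)
  also have "\<dots> = (\<Sum>(k, l)\<in>{0..<N} \<times> exponent_box J N. \<Sum>K\<in>Pow J. (-1) ^ card K *
      (F ((\<lambda>j. l j + of_bool (j \<in> K))(i := k)) - F ((\<lambda>j. l j + of_bool (j \<in> K))(i := k + 1))))"
    unfolding alternating_sum_Pow_insert[OF insert.hyps(1,2)]
    by (rule sum.cong[OF refl], clarify, rule sum.cong[OF refl], simp only: shift)
  also have "\<dots> = (\<Sum>l\<in>exponent_box J N. \<Sum>K\<in>Pow J. (-1) ^ card K * (\<Sum>k\<in>{0..<N}.
      F ((\<lambda>j. l j + of_bool (j \<in> K))(i := k)) - F ((\<lambda>j. l j + of_bool (j \<in> K))(i := k + 1))))"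
    unfolding sum.cartesian_product[symmetric]
    by (subst sum.swap, intro sum.cong refl, subst sum.swap) (simp add: sum_distrib_left)
  also have "\<dots> = (\<Sum>l\<in>exponent_box J N. \<Sum>K\<in>Pow J. (-1) ^ card K * F' (\<lambda>j. l j + of_bool (j \<in> K)))"
    by (simp only: telescope)
  also have "\<dots> = (\<Sum>K\<in>Pow J. (-1) ^ card K * F' (\<lambda>j. if j \<in> K then N else 0))"
    by (rule insert.IH)
  also have "\<dots> = (\<Sum>K\<in>Pow J. (-1) ^ card K *
      (F (\<lambda>j. if j \<in> K then N else 0) - F (\<lambda>j. if j \<in> insert i K then N else 0)))"
  proof (intro sum.cong refl)
    fix K assume "K \<in> Pow J"
    then have "(\<lambda>j. if j \<in> K then N else 0)(i := 0) = (\<lambda>j. if j \<in> K then N else 0)"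
      "(\<lambda>j. if j \<in> K then N else 0)(i := N) = (\<lambda>j. if j \<in> insert i K then N else 0)"
      using insert.hyps(2) by (auto simp: fun_eq_iff)
    then show "(-1) ^ card K * F' (\<lambda>j. if j \<in> K then N else 0) = (-1) ^ card K *
      (F (\<lambda>j. if j \<in> K then N else 0) - F (\<lambda>j. if j \<in> insert i K then N else 0))"
      by (simp add: F'_def)
  qed
  also have "\<dots> = (\<Sum>K\<in>Pow (insert i J). (-1) ^ card K * F (\<lambda>j. if j \<in> K then N else 0))"
    by (rule alternating_sum_Pow_insert[OF insert.hyps(1,2), symmetric])
  finally show ?case .
qed

text \<open>
  At every vertex of the cube the difference in direction \<open>i\<close> equals \<open>1\<close>, so taking a further difference in a second direction
  gives zero.
\<close>

lemma mixed_difference_eq_0: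
  fixes F :: "('i \<Rightarrow> int) \<Rightarrow> int"
  assumes J: "finite J" "i \<in> J" "card J > 1"
    and step: "\<And>m. c \<le> m i \<Longrightarrow> F (m(i := m i + 1)) = F m + 1"
    and l: "c \<le> l i"
  shows "(\<Sum>K\<in>Pow J. (-1) ^ card K * F (\<lambda>j. l j + of_bool (j \<in> K))) = 0"
proof -
  define A where "A = J - {i}"
  have A: "finite A" "i \<notin> A" "J = insert i A" using J by (auto simp: A_def)
  have "A \<noteq> {}" using J(3) A by auto
  then obtain k where "k \<in> A" by blast
  define A' where "A' = A - {k}"
  have A': "finite A'" "k \<notin> A'" "A = insert k A'" using A \<open>k \<in> A\<close> by (auto simp: A'_def)
  have "(\<Sum>K\<in>Pow J. (-1) ^ card K * F (\<lambda>j. l j + of_bool (j \<in> K))) =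
    (\<Sum>K\<in>Pow A. (-1) ^ card K * (F (\<lambda>j. l j + of_bool (j \<in> K)) - F (\<lambda>j. l j + of_bool (j \<in> insert i K))))"
    unfolding A(3) by (rule alternating_sum_Pow_insert[OF A(1,2)])
  also have "\<dots> = (\<Sum>K\<in>Pow A. (-1) ^ card K * -1)"
  proof (intro sum.cong refl)
    fix K assume K: "K \<in> Pow A"
    define m where "m j = l j + of_bool (j \<in> K)" for j
    have "(\<lambda>j. l j + of_bool (j \<in> insert i K)) = m(i := m i + 1)"
      using K A(2) by (auto simp: m_def fun_eq_iff)
    moreover have "c \<le> m i" using l by (simp add: m_def of_bool_def)
    ultimately have "F (\<lambda>j. l j + of_bool (j \<in> insert i K)) = F m + 1"
      by (simp only: step)
    moreover have "F (\<lambda>j. l j + of_bool (j \<in> K)) = F m" by (simp add: m_def[abs_def])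
    ultimately show "(-1) ^ card K * (F (\<lambda>j. l j + of_bool (j \<in> K)) -
        F (\<lambda>j. l j + of_bool (j \<in> insert i K))) = (-1) ^ card K * -1"
      by (simp only:) simp
  qed
  also have "\<dots> = 0"
    unfolding A'(3) alternating_sum_Pow_insert[OF A'(1,2), of "\<lambda>_. -1"] by simp
  finally show ?thesis .
qed

section \<open>The delta invariant and the Poincare series\<close>

lemma poincare_coeff_alt:
  "poincare_coeff \<gamma> J l =
    - (\<Sum>K\<in>Pow J. (-1) ^ card K * int (the_enat (hilbert_function \<gamma> J (\<lambda>i. l i + of_bool (i \<in> K)))))"
  by (simp add: poincare_coeff_def sum_negf)

text \<open>
  The coefficients are the differences of the Hilbert function of the branch.
\<close>

lemma poincare_fps_partial_sum:
  "(\<Sum>l<n. fps_nth (poincare_fps \<gamma> i) l) = int (the_enat (hilbert_function \<gamma> {i} (\<lambda>_. int n)))"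
proof -
  define h where "h k = int (the_enat (hilbert_function \<gamma> {i} (\<lambda>_. k)))" for k
  have h: "int (the_enat (hilbert_function \<gamma> {i} l)) = h (l i)" for l
    by (simp add: h_def hilbert_function_def val_ideal_def)
  have "fps_nth (poincare_fps \<gamma> i) l = h (int (Suc l)) - h (int l)" for l
    by (simp add: poincare_fps_def poincare_coeff_def h Pow_insert add.commute)
  then have "(\<Sum>l<n. fps_nth (poincare_fps \<gamma> i) l) = h (int n) - h (int 0)"
    by (simp only: sum_lessThan_telescope[of "\<lambda>l. h (int l)"])
  also have "h (int 0) = 0" by (simp add: h_def hilbert_function_0 zero_enat_def)
  finally show ?thesis by (simp add: h_def)
qed

theorem theorem4p1:
  fixes X :: "(complex ^ 'n) set"
    and I :: "'i set"
    and C :: "'i \<Rightarrow> (complex ^ 'n) set"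
    and \<gamma> :: "'i \<Rightarrow> complex \<Rightarrow> complex ^ 'n"
  assumes "curve_germ X"
    and "irreducible_decomposition I C X"
    and "\<And>i. i \<in> I \<Longrightarrow> normalization (\<gamma> i) (C i)"
  shows
    \<comment> \<open>the first three conjuncts say that all quantities involved are well defined\<close>
    "(\<forall>J\<subseteq>I. delta \<gamma> J \<noteq> \<infinity> \<and> (\<forall>l. hilbert_function \<gamma> J l \<noteq> \<infinity>)) \<and>
     (\<forall>i\<in>I. \<exists>x. has_periodic_constant (poincare_fps \<gamma> i) x) \<and>
     (\<forall>J\<subseteq>I. card J > 1 \<longrightarrow> is_polynomial_series J (poincare_coeff \<gamma> J)) \<and>
     (\<forall>i\<in>I. real (the_enat (delta \<gamma> {i})) = - periodic_constant (poincare_fps \<gamma> i)) \<and>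
     int (the_enat (delta \<gamma> I)) =
       (\<Sum>i\<in>I. int (the_enat (delta \<gamma> {i}))) +
       (\<Sum>J\<in>{J. J \<subseteq> I \<and> card J > 1}. (-1) ^ card J * series_at_one J (poincare_coeff \<gamma> J))"
proof -
  obtain c where c: "\<And>J. J \<subseteq> I \<Longrightarrow>
      normalization_ring J \<inter> order_filtration J (\<lambda>_. int c) \<subseteq> multi_pullback \<gamma> J ` holomorphic_germs"
  proof (rule curve_conductor[OF assms(2)])
    show "normalization (\<gamma> i) (C i)" if "i \<in> I" for i by (rule assms(3)[OF that])
  qed (rule that)
  have finI: "finite I" using assms(2) by (simp add: irreducible_decomposition_def)
  have fin: "finite J" if "J \<subseteq> I" for J using that finI finite_subset by blast
  have nrm: "\<forall>j\<in>J. normalization (\<gamma> j) (C j)" if "J \<subseteq> I" for J using assms(3) that by blast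
  define d where "d J = int (the_enat (delta \<gamma> J))" for J
  define h where "h J l = int (the_enat (hilbert_function \<gamma> J l))" for J l
  have sum: "delta \<gamma> J + hilbert_function \<gamma> J (\<lambda>_. int n) = enat (n * card J)"
    if "J \<subseteq> I" "n \<ge> c" for J n
    by (rule hilbert_function_plus_delta[OF fin[OF that(1)] nrm[OF that(1)] c[OF that(1)] that(2)])
  have delta_fin: "delta \<gamma> J \<noteq> \<infinity>" if "J \<subseteq> I" for J
    using sum[OF that order_refl] by (metis enat.simps(3) plus_enat_simps(2))
  have hilbert_fin: "hilbert_function \<gamma> J l \<noteq> \<infinity>" if "J \<subseteq> I" for J l
    by (rule hilbert_function_finite[OF fin[OF that] nrm[OF that]])
  have h_large: "h J (\<lambda>_. int n) = int n * int (card J) - d J" if J: "J \<subseteq> I" and n: "n \<ge> c" for J n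
  proof -
    obtain x y where xy: "delta \<gamma> J = enat x" "hilbert_function \<gamma> J (\<lambda>_. int n) = enat y"
      using delta_fin[OF J] hilbert_fin[OF J, of "\<lambda>_. int n"] unfolding not_infinity_eq by blast
    then have "x + y = n * card J" using sum[OF J n] by simp
    then have "int x + int y = int n * int (card J)" by (metis of_nat_add of_nat_mult)
    then show ?thesis by (simp add: h_def d_def xy)
  qed
  have h_step: "h J (l(i := l i + 1)) = h J l + 1" if J: "J \<subseteq> I" and i: "i \<in> J" "int c \<le> l i" for J l i
  proof -
    obtain y where "hilbert_function \<gamma> J l = enat y"
      using hilbert_fin[OF J, of l] unfolding not_infinity_eq by blast
    then show ?thesis
      using hilbert_function_step_above_conductor[OF nrm[OF J] c[OF J] i(1), of l] i(2)
      by (simp add: h_def one_enat_def del: fun_upd_apply)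
  qed
  have coeff: "poincare_coeff \<gamma> J l = - (\<Sum>K\<in>Pow J. (-1) ^ card K * h J (\<lambda>i. l i + of_bool (i \<in> K)))" for J l
    unfolding h_def by (rule poincare_coeff_alt)
  have pc: "has_periodic_constant (poincare_fps \<gamma> i) (- real (the_enat (delta \<gamma> {i})))" if i: "i \<in> I" for i
  proof -
    have "real_of_int (\<Sum>l<1 * n. fps_nth (poincare_fps \<gamma> i) l) =
        poly [:- real (the_enat (delta \<gamma> {i})), 1:] (real n)" if "n \<ge> c" for n
      using h_large[of "{i}" n] i that unfolding poincare_fps_partial_sum
      by (simp add: h_def d_def)
    then show ?thesis
      unfolding has_periodic_constant_def eventually_sequentially
      by (intro exI[of _ 1] conjI exI[of _ "[:- real (the_enat (delta \<gamma> {i})), 1:]"] exI[of _ c]) auto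
  qed
  have supp: "series_support J (poincare_coeff \<gamma> J) \<subseteq> exponent_box J (int c)"
    if J: "J \<subseteq> I" "card J > 1" for J
  proof
    fix l assume l: "l \<in> series_support J (poincare_coeff \<gamma> J)"
    then have ne: "poincare_coeff \<gamma> J l \<noteq> 0" by (simp add: series_support_def)
    have "0 \<le> l i" if "i \<in> J" for i
      using poincare_coeff_eq_0[OF fin[OF J(1)] that, of l \<gamma>] ne by force
    moreover have "l i < int c" if "i \<in> J" for i
    proof (rule ccontr)
      assume "\<not> l i < int c"
      then have "poincare_coeff \<gamma> J l = 0"
        unfolding coeff
        using mixed_difference_eq_0[OF fin[OF J(1)] \<open>i \<in> J\<close> J(2), of "int c" "h J" l] h_step[OF J(1) \<open>i \<in> J\<close>]
        by simp
      with ne show False by simp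
    qed
    ultimately show "l \<in> exponent_box J (int c)"
      using l by (auto simp: exponent_box_def series_support_def)
  qed
  have poly: "is_polynomial_series J (poincare_coeff \<gamma> J)" if J: "J \<subseteq> I" "card J > 1" for J
    unfolding is_polynomial_series_def
    using supp[OF J] finite_exponent_box[OF fin[OF J(1)], of "int c"] finite_subset
    by (fastforce simp: exponent_box_def)
  \<comment> \<open>Values of the Hilbert functions at the corner of the box, and their alternating sums.\<close>
  define E where "E K = h K (\<lambda>_. int c)" for K
  define G where "G J = (\<Sum>K\<in>Pow J. (-1) ^ card K * E K)" for J
  have at_one: "series_at_one J (poincare_coeff \<gamma> J) = - G J" if J: "J \<subseteq> I" "card J > 1" for J
  proof -
    have "series_at_one J (poincare_coeff \<gamma> J) = (\<Sum>l\<in>exponent_box J (int c). poincare_coeff \<gamma> J l)"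
      unfolding series_at_one_def
      using supp[OF J] finite_exponent_box[OF fin[OF J(1)], of "int c"]
      by (intro sum.mono_neutral_left) (auto simp: series_support_def exponent_box_def)
    also have "\<dots> = - (\<Sum>K\<in>Pow J. (-1) ^ card K * h J (\<lambda>i. if i \<in> K then int c else 0))"
      unfolding coeff sum_negf by (subst sum_exponent_box_mixed_difference[OF fin[OF J(1)]]) auto
    also have "\<dots> = - G J"
      unfolding G_def E_def h_def
      using hilbert_function_restrict[of _ J \<gamma> "\<lambda>_. int c"]
      by (intro arg_cong[of _ _ uminus] sum.cong refl) simp
    finally show ?thesis .
  qed
  \<comment> \<open>Moebius inversion; the terms with \<open>card J \<le> 1\<close> are computed separately, as the sum over the box
    is a value of the Poincare series only for \<open>card J > 1\<close>.\<close>
  have "E I = (\<Sum>J\<in>Pow I. (-1) ^ card J * G J)"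
    by (rule inclusion_exclusion_symmetric[of G E, OF _ finI]) (simp add: G_def)
  also have "Pow I = {J. J \<subseteq> I \<and> card J > 1} \<union> insert {} ((\<lambda>i. {i}) ` I)"
  proof (intro equalityI subsetI)
    fix J assume J: "J \<in> Pow I"
    show "J \<in> {J. J \<subseteq> I \<and> card J > 1} \<union> insert {} ((\<lambda>i. {i}) ` I)"
    proof (cases "card J > 1 \<or> J = {}")
      case False
      moreover have "card J \<noteq> 0" using False J fin[of J] by auto
      ultimately have "card J = 1" by linarith
      then obtain i where "J = {i}" by (rule card_1_singletonE)
      then show ?thesis using J by auto
    qed (use J in auto)
  qed auto
  also have "(\<Sum>J\<in>{J. J \<subseteq> I \<and> card J > 1} \<union> insert {} ((\<lambda>i. {i}) ` I). (-1) ^ card J * G J) =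
      (\<Sum>J\<in>{J. J \<subseteq> I \<and> card J > 1}. (-1) ^ card J * G J) +
      (\<Sum>J\<in>insert {} ((\<lambda>i. {i}) ` I). (-1) ^ card J * G J)"
    using finI by (intro sum.union_disjoint) auto
  also have "(\<Sum>J\<in>insert {} ((\<lambda>i. {i}) ` I). (-1) ^ card J * G J) = G {} - (\<Sum>i\<in>I. G {i})"
    using finI by (subst sum.insert) (auto simp: sum.reindex sum_negf)
  also have "G {} = E {}" by (simp add: G_def)
  also have "(\<Sum>i\<in>I. G {i}) = (\<Sum>i\<in>I. E {} - E {i})"
    by (intro sum.cong refl) (simp add: G_def Pow_insert)
  also have "E {} = 0"
    using h_large[of "{}" c] by (simp add: E_def h_def hilbert_function_def val_ideal_def fun_space.quotient_dim_eq_0 zero_enat_def)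
  finally have "E I = (\<Sum>J\<in>{J. J \<subseteq> I \<and> card J > 1}. (-1) ^ card J * G J) + (\<Sum>i\<in>I. E {i})"
    by (simp add: sum_negf)
  moreover have "E I = int c * int (card I) - d I" unfolding E_def by (rule h_large) auto
  moreover have "(\<Sum>i\<in>I. E {i}) = int c * int (card I) - (\<Sum>i\<in>I. d {i})"
    using h_large[of "{_}" c] by (simp add: E_def sum_subtractf mult.commute)
  moreover have "(\<Sum>J\<in>{J. J \<subseteq> I \<and> card J > 1}. (-1) ^ card J * G J) =
      - (\<Sum>J\<in>{J. J \<subseteq> I \<and> card J > 1}. (-1) ^ card J * series_at_one J (poincare_coeff \<gamma> J))"
    by (simp add: at_one sum_negf)
  ultimately have "d I = (\<Sum>i\<in>I. d {i}) +
      (\<Sum>J\<in>{J. J \<subseteq> I \<and> card J > 1}. (-1) ^ card J * series_at_one J (poincare_coeff \<gamma> J))"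
    by linarith
  moreover have "real (the_enat (delta \<gamma> {i})) = - periodic_constant (poincare_fps \<gamma> i)" if "i \<in> I" for i
    using periodic_constantI[OF pc[OF that]] by simp
  ultimately show ?thesis
    using delta_fin hilbert_fin pc poly unfolding d_def by blast
qed

end
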